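(* Let $G$ be a Lie group with Lie algebra $\mathfrak g$, and let $E=E(\xi,\nu)$ be a smooth function on the Lie algebra $\mathfrak g_2\circledS\mathfrak g_3^*$ of the group $G\circledS\mathfrak g^*$. The Euler–Poincaré equations on $\mathfrak g_2\circledS\mathfrak g_3^*$ for $E$ (that is, the equations characterizing the curves $(\xi(t),\nu(t))$ extremal for $\int_a^bE\,dt$ under the variations $\delta(\xi,\nu)=\frac{d}{dt}(\eta,\lambda)+[(\xi,\nu),(\eta,\lambda)]_{\mathfrak g\circledS\mathfrak g^*}$ with $(\eta,\lambda)$ arbitrary and vanishing at the end points) are $$\frac{d}{dt}\Big(\frac{\delta E}{\delta\xi}\Big)=ad^*_\xi\Big(\frac{\delta E}{\delta\xi}\Big)-ad^*_{\frac{\delta E}{\delta\nu}}\nu,\qquad \frac{d}{dt}\Big(\frac{\delta E}{\delta\nu}\Big)=-ad_\xi\frac{\delta E}{\delta\nu}.$$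
   Context: Conventions. $G$ is a (finite-dimensional) Lie group, $\mathfrak g=T_eG$, $\mathfrak g^*$ its dual, $\mathfrak g^{**}=\mathfrak g$. $Ad_g$ is the tangent map at $e$ of $h\mapsto g^{-1}hg$; $\langle Ad^*_g\mu,\xi\rangle=\langle\mu,Ad_{g^{-1}}\xi\rangle$. The Lie bracket is $[\xi,\eta]=ad_\xi\eta=\frac{d}{dt}|_{t=0}Ad_{\exp(t\xi)}\eta$ (the bracket of right invariant vector fields). $\langle ad^*_\xi\mu,\eta\rangle=\langle\mu,[\xi,\eta]\rangle$. Partial derivatives: $\delta E/\delta\xi\in\mathfrak g^*$, $\delta E/\delta\nu\in\mathfrak g$. $G\circledS\mathfrak g^*$ is $G\times\mathfrak g^*$ with multiplication $(g,\mu)(h,\nu)=(gh,\mu+Ad^*_{g^{-1}}\nu)$; its Lie algebra $\mathfrak g\circledS\mathfrak g^*$ has bracket $$[(\xi,\nu),(\eta,\lambda)]_{\mathfrak g\circledS\mathfrak g^*}=([\xi,\eta],\,ad^*_\eta\nu-ad^*_\xi\lambda).$$ Subscripts on copies of $\mathfrak g,\mathfrak g^*$ are only labels. *)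

theory Defs
  imports "HOL-Analysis.Analysis" "HOL-Algebra.Group"
begin

section \<open>Smooth maps\<close>

text \<open>
  Continuous differentiability of order \<open>k\<close>, by iterated directional derivatives, and smoothness.
  The set \<open>S\<close> is meant to be open, or an interval \<open>{a..b}\<close> with \<open>a < b\<close> (one-sided derivatives at
  the end points), so that the derivative within \<open>S\<close> is unique; the domain type is meant to be
  finite-dimensional.
\<close>

primrec Ck_on ::
  "nat \<Rightarrow> 'a::real_normed_vector set \<Rightarrow> ('a \<Rightarrow> 'b::real_normed_vector) \<Rightarrow> bool" where
  "Ck_on 0 S f \<longleftrightarrow> continuous_on S f"
| "Ck_on (Suc k) S f \<longleftrightarrow>
     f differentiable_on S \<and> (\<forall>v. Ck_on k S (\<lambda>x. frechet_derivative f (at x within S) v))"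

definition smooth_on ::
  "'a::real_normed_vector set \<Rightarrow> ('a \<Rightarrow> 'b::real_normed_vector) \<Rightarrow> bool" where
  "smooth_on S f \<longleftrightarrow> (\<forall>k. Ck_on k S f)"


section \<open>Lie groups\<close>

text \<open>
  An atlas is a set of charts \<open>(U, \<phi>)\<close>, where only the values of \<open>\<phi>\<close> on \<open>U\<close> are relevant. It
  need not be maximal.
\<close>

locale smooth_manifold =
  fixes T :: "'g topology"
    and atlas :: "('g set \<times> ('g \<Rightarrow> 'a::euclidean_space)) set"
  assumes hausdorff: "Hausdorff_space T"
    and second_countable: "second_countable T"
    and covering: "\<Union> (fst ` atlas) = topspace T"
    and chart_domain: "(U, \<phi>) \<in> atlas \<Longrightarrow> openin T U"
    and chart_image: "(U, \<phi>) \<in> atlas \<Longrightarrow> open (\<phi> ` U)"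
    and chart_homeomorphic:
      "(U, \<phi>) \<in> atlas \<Longrightarrow> homeomorphic_map (subtopology T U) (top_of_set (\<phi> ` U)) \<phi>"
    and compatible:
      "(U, \<phi>) \<in> atlas \<Longrightarrow> (V, \<psi>) \<in> atlas \<Longrightarrow>
         smooth_on (\<phi> ` (U \<inter> V)) (\<lambda>x. \<psi> (inv_into U \<phi> x))"

locale lie_group = group G + smooth_manifold T atlas
  for G (structure)
    and T :: "'g topology"
    and atlas :: "('g set \<times> ('g \<Rightarrow> 'a::euclidean_space)) set" +
  assumes topspace_carrier: "topspace T = carrier G"
    and continuous_mult: "continuous_map (prod_topology T T) T (\<lambda>(g, h). g \<otimes> h)"
    and continuous_inverse: "continuous_map T T (\<lambda>g. inv g)"
    and smooth_mult:
      "(U, \<phi>) \<in> atlas \<Longrightarrow> (V, \<psi>) \<in> atlas \<Longrightarrow> (W, \<theta>) \<in> atlas \<Longrightarrow>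
         smooth_on {(x, y). x \<in> \<phi> ` U \<and> y \<in> \<psi> ` V \<and> inv_into U \<phi> x \<otimes> inv_into V \<psi> y \<in> W}
           (\<lambda>(x, y). \<theta> (inv_into U \<phi> x \<otimes> inv_into V \<psi> y))"
    and smooth_inverse:
      "(U, \<phi>) \<in> atlas \<Longrightarrow> (W, \<theta>) \<in> atlas \<Longrightarrow>
         smooth_on {x. x \<in> \<phi> ` U \<and> inv (inv_into U \<phi> x) \<in> W} (\<lambda>x. \<theta> (inv (inv_into U \<phi> x)))"


section \<open>The Lie algebra of a Lie group\<close>

text \<open>
  Fix a chart \<open>(U, \<phi>)\<close> around the unit element. The derivative of \<open>\<phi>\<close> identifies the tangent space
  at the unit element with the model space \<open>'a\<close> of the manifold, and tangent vectors are represented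
  by elements of \<open>'a\<close> throughout.

  \<open>Ad\<close> is the tangent map of \<open>h \<mapsto> g\<^sup>-\<^sup>1 h g\<close> (and not of \<open>h \<mapsto> g h g\<^sup>-\<^sup>1\<close>), so that
  \<open>lie_bracket\<close> is the bracket of right invariant vector fields.
\<close>

definition Ad ::
  "('g, 'm) monoid_scheme \<Rightarrow> 'g set \<Rightarrow> ('g \<Rightarrow> 'a::euclidean_space) \<Rightarrow> 'g \<Rightarrow> 'a \<Rightarrow> 'a" where
  "Ad G U \<phi> g =
     frechet_derivative (\<lambda>x. \<phi> (inv\<^bsub>G\<^esub> g \<otimes>\<^bsub>G\<^esub> inv_into U \<phi> x \<otimes>\<^bsub>G\<^esub> g)) (at (\<phi> \<one>\<^bsub>G\<^esub>))"

text \<open>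
  Continuous homomorphisms from the reals to a Lie group are smooth, so that no further regularity
  needs to be required of a one-parameter subgroup.
\<close>

definition one_parameter_subgroup ::
  "('g, 'm) monoid_scheme \<Rightarrow> 'g topology \<Rightarrow> ('g \<Rightarrow> 'a::euclidean_space) \<Rightarrow> 'a \<Rightarrow> (real \<Rightarrow> 'g) \<Rightarrow> bool"
  where
  "one_parameter_subgroup G T \<phi> \<xi> c \<longleftrightarrow>
     continuous_map euclideanreal T c \<and>
     (\<forall>s t. c (s + t) = c s \<otimes>\<^bsub>G\<^esub> c t) \<and>
     ((\<lambda>t. \<phi> (c t)) has_vector_derivative \<xi>) (at 0)"

definition lie_exp ::
  "('g, 'm) monoid_scheme \<Rightarrow> 'g topology \<Rightarrow> ('g \<Rightarrow> 'a::euclidean_space) \<Rightarrow> 'a \<Rightarrow> 'g" where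
  "lie_exp G T \<phi> \<xi> = (THE c. one_parameter_subgroup G T \<phi> \<xi> c) 1"

definition lie_bracket ::
  "('g, 'm) monoid_scheme \<Rightarrow> 'g topology \<Rightarrow> 'g set \<Rightarrow> ('g \<Rightarrow> 'a::euclidean_space) \<Rightarrow> 'a \<Rightarrow> 'a \<Rightarrow> 'a"
  where
  "lie_bracket G T U \<phi> \<xi> \<eta> =
     vector_derivative (\<lambda>t. Ad G U \<phi> (lie_exp G T \<phi> (t *\<^sub>R \<xi>)) \<eta>) (at 0)"


section \<open>The semidirect product Lie algebra\<close>

text \<open>
  The dual of \<open>'a\<close> is the space \<open>'a \<Rightarrow>\<^sub>L real\<close>. The argument \<open>br\<close> is the bracket of the Lie algebra.
\<close>

definition ad_star ::
  "('a \<Rightarrow> 'a \<Rightarrow> 'a) \<Rightarrow> 'a::euclidean_space \<Rightarrow> ('a \<Rightarrow>\<^sub>L real) \<Rightarrow> ('a \<Rightarrow>\<^sub>L real)" where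
  "ad_star br \<xi> \<mu> = Blinfun (\<lambda>\<eta>. blinfun_apply \<mu> (br \<xi> \<eta>))"

definition semidirect_bracket ::
  "('a \<Rightarrow> 'a \<Rightarrow> 'a) \<Rightarrow> 'a::euclidean_space \<times> ('a \<Rightarrow>\<^sub>L real) \<Rightarrow> 'a \<times> ('a \<Rightarrow>\<^sub>L real)
     \<Rightarrow> 'a \<times> ('a \<Rightarrow>\<^sub>L real)" where
  "semidirect_bracket br = (\<lambda>(\<xi>, \<nu>) (\<eta>, \<zeta>). (br \<xi> \<eta>, ad_star br \<eta> \<nu> - ad_star br \<xi> \<zeta>))"


section \<open>The variational principle\<close>

text \<open>
  The partial derivative with respect to the second variable is a functional on the dual of \<open>'a\<close>,
  which is evaluation at a unique element of \<open>'a\<close>.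
\<close>

definition partial_fst ::
  "('a::euclidean_space \<times> ('a \<Rightarrow>\<^sub>L real) \<Rightarrow> real) \<Rightarrow> 'a \<Rightarrow> ('a \<Rightarrow>\<^sub>L real) \<Rightarrow> ('a \<Rightarrow>\<^sub>L real)" where
  "partial_fst E \<xi> \<nu> = Blinfun (frechet_derivative (\<lambda>x. E (x, \<nu>)) (at \<xi>))"

definition partial_snd ::
  "('a::euclidean_space \<times> ('a \<Rightarrow>\<^sub>L real) \<Rightarrow> real) \<Rightarrow> 'a \<Rightarrow> ('a \<Rightarrow>\<^sub>L real) \<Rightarrow> 'a" where
  "partial_snd E \<xi> \<nu> =
     (THE v. \<forall>\<mu>. frechet_derivative (\<lambda>m. E (\<xi>, m)) (at \<nu>) \<mu> = blinfun_apply \<mu> v)"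

text \<open>
  A curve is extremal if the first variation of the action, that is its derivative along
  \<open>\<epsilon> \<mapsto> \<gamma> + \<epsilon> \<delta>\<gamma>\<close> at \<open>\<epsilon> = 0\<close>, vanishes for all variations
  \<open>\<delta>\<gamma> = \<sigma>' + [\<gamma>, \<sigma>]\<close> with \<open>\<sigma>\<close> vanishing at the end points.
\<close>

definition extremal ::
  "('a \<Rightarrow> 'a \<Rightarrow> 'a) \<Rightarrow> ('a::euclidean_space \<times> ('a \<Rightarrow>\<^sub>L real) \<Rightarrow> real) \<Rightarrow> real \<Rightarrow> real
     \<Rightarrow> (real \<Rightarrow> 'a \<times> ('a \<Rightarrow>\<^sub>L real)) \<Rightarrow> bool" where
  "extremal br E a b \<gamma> \<longleftrightarrow>
     (\<forall>\<sigma>. smooth_on {a..b} \<sigma> \<and> \<sigma> a = 0 \<and> \<sigma> b = 0 \<longrightarrow>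
       ((\<lambda>\<epsilon>. integral {a..b} (\<lambda>t. E (\<gamma> t + \<epsilon> *\<^sub>R
            (vector_derivative \<sigma> (at t within {a..b}) + semidirect_bracket br (\<gamma> t) (\<sigma> t)))))
          has_real_derivative 0) (at 0))"

end

theory Submission
  imports Defs
begin

text \<open>
  Pairing the first variation with a variation \<open>(\<eta>, \<zeta>)\<close> gives the integral of
  \<open>P\<^sub>1 \<eta>' + Q\<^sub>1 \<eta> + \<zeta>' P\<^sub>2 + \<zeta> Q\<^sub>2\<close>, where \<open>P\<^sub>1, P\<^sub>2\<close> are the partial derivatives of \<open>E\<close> along
  the curve and \<open>Q\<^sub>1, Q\<^sub>2\<close> the right-hand sides of the equations; the lemma of du Bois-Reymond,
  tested on polynomials only, turns its vanishing into \<open>P\<^sub>1' = Q\<^sub>1\<close> and \<open>P\<^sub>2' = Q\<^sub>2\<close>. The only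
  properties of the bracket that enter are bilinearity and \<open>[\<xi>, \<xi>] = 0\<close>.

  Since the bracket is defined through the exponential map, these properties require one-parameter
  subgroups. Two curves with the same left logarithmic derivative have a quotient with derivative
  zero in a chart. This gives uniqueness, and shows that an integral curve of a left invariant
  vector field is a local homomorphism, which extends to the real line by \<open>t \<mapsto> c (t / n)\<^sup>n\<close>. Then
  \<open>[\<xi>, \<eta>]\<close> is the derivative at the unit element, in the direction \<open>\<xi>\<close>, of \<open>g \<mapsto> Ad g \<eta>\<close>. This
  is bilinear, and it vanishes for \<open>\<eta> = \<xi>\<close> because a one-parameter subgroup is commutative.
\<close>

section \<open>Smoothness\<close>

text \<open>\<open>frechet_derivative\<close> chooses some derivative. Functions that agree on
  \<open>S\<close> have the same derivatives within \<open>S\<close> at its points, so the choices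
  coincide even where the derivative is not unique.\<close>

lemma Ck_on_cong:
  assumes "\<And>x. x \<in> S \<Longrightarrow> f x = g x" and "Ck_on k S f"
  shows "Ck_on k S g"
  using assms
proof (induction k arbitrary: f g)
  case 0
  then show ?case using continuous_on_cong by fastforce
next
  case (Suc k)
  have *: "(g has_derivative D) (at x within S)" if "(f has_derivative D) (at x within S)" "x \<in> S" for D x
    using that has_derivative_transform[of x S g f D] Suc.prems(1) by auto
  have **: "(f has_derivative D) (at x within S)" if "(g has_derivative D) (at x within S)" "x \<in> S" for D x
    using that has_derivative_transform[of x S f g D] Suc.prems(1) by auto
  have "(f has_derivative D) (at x within S) \<longleftrightarrow> (g has_derivative D) (at x within S)" if "x \<in> S" for D x
    using * ** that by blast
  then have 1: "frechet_derivative f (at x within S) = frechet_derivative g (at x within S)"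
    and 2: "f differentiable at x within S \<longleftrightarrow> g differentiable at x within S" if "x \<in> S" for x
    using that by (simp_all add: frechet_derivative_def differentiable_def)
  have "g differentiable_on S"
    using Suc.prems(2) 2 by (simp add: differentiable_on_def)
  moreover have "Ck_on k S (\<lambda>x. frechet_derivative g (at x within S) v)" for v
    by (rule Suc.IH[of "\<lambda>x. frechet_derivative f (at x within S) v"]) (use 1 Suc.prems(2) in auto)
  ultimately show ?case by simp
qed

text \<open>As \<open>a < b\<close>, derivatives within the interval are unique also at the end
  points, which pins down the chosen one.\<close>

lemma frechet_derivative_within_real:
  fixes f :: "real \<Rightarrow> 'b::real_normed_vector"
  assumes "a < b" "t \<in> {a..b}" "(f has_vector_derivative f') (at t within {a..b})"
  shows "frechet_derivative f (at t within {a..b}) = (\<lambda>h. h *\<^sub>R f')"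
proof -
  have D: "(f has_derivative (\<lambda>h. h *\<^sub>R f')) (at t within {a..b})"
    using assms(3) by (simp add: has_vector_derivative_def)
  then have "(f has_derivative frechet_derivative f (at t within {a..b})) (at t within {a..b})"
    using frechet_derivative_works differentiable_def by blast
  with D show ?thesis
    using frechet_derivative_unique_within_closed_interval[of a b t f] assms(1,2) by auto
qed

text \<open>These are the test curves of the variational argument. Differentiation in direction
  \<open>h\<close> gives \<open>p'\<close> times \<open>h *\<^sub>R v\<close>, a curve of the same
  form, so the induction varies both \<open>p\<close> and \<open>v\<close>.\<close>

lemma smooth_on_polynomial_scaleR:
  fixes v :: "'b::real_normed_vector"
  assumes "a < b" "real_polynomial_function p"
  shows "smooth_on {a..b} (\<lambda>t::real. p t *\<^sub>R v)"
  unfolding smooth_on_def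
proof
  fix k show "Ck_on k {a..b} (\<lambda>t. p t *\<^sub>R v)"
    using assms(2)
  proof (induction k arbitrary: p v)
    case 0
    then show ?case
      by (auto intro!: continuous_intros continuous_on_polymonial_function simp: real_polynomial_function_eq)
  next
    case (Suc k)
    obtain p' where p': "real_polynomial_function p'" "\<And>x. (p has_real_derivative p' x) (at x)"
      using has_real_derivative_polynomial_function[OF Suc.prems] by auto
    have D: "((\<lambda>t. p t *\<^sub>R v) has_vector_derivative p' t *\<^sub>R v) (at t within {a..b})" for t
    proof -
      have "(p has_real_derivative p' t) (at t within {a..b})"
        using p'(2) by (rule has_field_derivative_at_within)
      from has_vector_derivative_scaleR[OF this has_vector_derivative_const] show ?thesis by simp
    qed
    have "Ck_on k {a..b} (\<lambda>t. frechet_derivative (\<lambda>t. p t *\<^sub>R v) (at t within {a..b}) h)" for h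
    proof (rule Ck_on_cong[OF _ Suc.IH[OF p'(1)]])
      fix t assume "t \<in> {a..b}"
      then show "p' t *\<^sub>R (h *\<^sub>R v) = frechet_derivative (\<lambda>t. p t *\<^sub>R v) (at t within {a..b}) h"
        by (subst frechet_derivative_within_real[OF assms(1) _ D]) (auto simp: mult.commute)
    qed
    then show ?case
      using D by (auto simp: differentiable_on_def differentiable_def has_vector_derivative_def)
  qed
qed

lemma smooth_on_curve_C1:
  fixes \<sigma> :: "real \<Rightarrow> 'b::real_normed_vector"
  assumes "a < b" "smooth_on {a..b} \<sigma>"
  shows "\<And>t. t \<in> {a..b} \<Longrightarrow>
      (\<sigma> has_vector_derivative vector_derivative \<sigma> (at t within {a..b})) (at t within {a..b})"
    and "continuous_on {a..b} (\<lambda>t. vector_derivative \<sigma> (at t within {a..b}))"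
    and "continuous_on {a..b} \<sigma>"
proof -
  have C: "Ck_on (Suc 0) {a..b} \<sigma>"
    using assms(2) by (auto simp only: smooth_on_def)
  show D: "(\<sigma> has_vector_derivative vector_derivative \<sigma> (at t within {a..b})) (at t within {a..b})"
    if "t \<in> {a..b}" for t
    using C that by (auto simp: differentiable_on_def vector_derivative_works)
  show "continuous_on {a..b} \<sigma>"
    using C by (auto simp: differentiable_imp_continuous_on)
  \<comment> \<open>Direction \<open>1\<close> turns the Frechet derivative into the vector
    derivative.\<close>
  have "continuous_on {a..b} (\<lambda>t. frechet_derivative \<sigma> (at t within {a..b}) 1)"
    using C by auto
  then show "continuous_on {a..b} (\<lambda>t. vector_derivative \<sigma> (at t within {a..b}))"
    by (rule continuous_on_eq) (subst frechet_derivative_within_real[OF assms(1) _ D], auto)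
qed


section \<open>The fundamental lemma of the calculus of variations\<close>

lemma real_polynomial_function_antiderivative:
  fixes p :: "real \<Rightarrow> real"
  assumes "real_polynomial_function p"
  obtains q where "real_polynomial_function q" "\<And>x. (q has_real_derivative p x) (at x)"
proof -
  obtain c n where p: "p = (\<lambda>x. \<Sum>i\<le>n. c i * x ^ i)"
    using assms real_polynomial_function_iff_sum by blast
  define q where "q = (\<lambda>x::real. \<Sum>i\<le>n. (c i / real (Suc i)) * x ^ Suc i)"
  have "real_polynomial_function q"
    unfolding q_def
    by (intro real_polynomial_function_sum real_polynomial_function.intros(4) real_polynomial_function.intros(2)
        real_polynomial_function_power real_polynomial_function.intros(1)) auto
  moreover have "(q has_real_derivative p x) (at x)" for x
    unfolding q_def p
  proof (rule DERIV_sum)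
    fix i
    have "((\<lambda>x. x ^ Suc i) has_real_derivative real (Suc i) * x ^ i) (at x)"
      using DERIV_pow[of "Suc i" x] by simp
    from DERIV_cmult[OF this, of "c i / real (Suc i)"]
    show "((\<lambda>x. c i / real (Suc i) * x ^ Suc i) has_real_derivative c i * x ^ i) (at x)"
      by (simp del: power_Suc of_nat_Suc)
  qed
  ultimately show ?thesis using that by blast
qed

text \<open>By Weierstrass, one factor of \<open>f * f\<close> can be replaced by a uniformly close
  polynomial, at a cost of at most \<open>e\<close> times the integral of the absolute value of
  \<open>f\<close>. By orthogonality the integral of \<open>f * f\<close> is then arbitrarily
  small.\<close>

lemma continuous_orthogonal_polynomials_eq_0:
  fixes f :: "real \<Rightarrow> real"
  assumes "a < b" and f: "continuous_on {a..b} f"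
    and orth: "\<And>p. real_polynomial_function p \<Longrightarrow> integral {a..b} (\<lambda>t. f t * p t) = 0"
    and "t \<in> {a..b}"
  shows "f t = 0"
proof -
  have int: "(\<lambda>t. f t * f t) integrable_on {a..b}"
    by (intro integrable_continuous_real continuous_intros f)
  define M where "M = integral {a..b} (\<lambda>t. \<bar>f t\<bar>)"
  have "integral {a..b} (\<lambda>t. f t * f t) \<le> e * M" if "e > 0" for e
  proof -
    obtain p where p: "real_polynomial_function p" "\<And>x. x \<in> {a..b} \<Longrightarrow> \<bar>f x - p x\<bar> < e"
      using Stone_Weierstrass_real_polynomial_function[OF compact_Icc f \<open>e > 0\<close>] by metis
    have cp: "continuous_on {a..b} p"
      using p(1) by (auto intro!: continuous_on_polymonial_function simp: real_polynomial_function_eq)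
    have "integral {a..b} (\<lambda>t. f t * f t) = integral {a..b} (\<lambda>t. f t * f t) - integral {a..b} (\<lambda>t. f t * p t)"
      using orth[OF p(1)] by simp
    also have "\<dots> = integral {a..b} (\<lambda>t. f t * f t - f t * p t)"
      by (intro integral_diff[symmetric] integrable_continuous_real continuous_intros f cp)
    also have "\<dots> \<le> integral {a..b} (\<lambda>t. e * \<bar>f t\<bar>)"
    proof (intro integral_le integrable_continuous_real continuous_intros f cp)
      fix t assume "t \<in> {a..b}"
      then have "\<bar>f t - p t\<bar> * \<bar>f t\<bar> \<le> e * \<bar>f t\<bar>"
        using p(2) by (intro mult_right_mono) (auto intro: less_imp_le)
      then show "f t * f t - f t * p t \<le> e * \<bar>f t\<bar>"
        by (metis abs_le_D1 abs_mult mult.commute order_trans right_diff_distrib)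
    qed
    finally show ?thesis by (simp add: M_def)
  qed
  moreover have "M \<ge> 0"
    unfolding M_def by (intro integral_nonneg integrable_continuous_real continuous_intros f) auto
  \<comment> \<open>For nonzero \<open>M\<close> the bound is applied with
    \<open>e / M\<close>.\<close>
  ultimately have "integral {a..b} (\<lambda>t. f t * f t) \<le> 0 + e" if "e > 0" for e
    using that zero_less_mult_pos2[of e M] by (cases "M = 0") (force, metis add_0 divide_pos_pos
        less_eq_real_def nonzero_eq_divide_eq)
  then have "integral {a..b} (\<lambda>t. f t * f t) \<le> 0"
    using field_le_epsilon by blast
  moreover have "integral {a..b} (\<lambda>t. f t * f t) \<ge> 0"
    by (intro integral_nonneg int) auto
  ultimately have "integral {a..b} (\<lambda>t. f t * f t) = 0" by simp
  then have "\<forall>x\<in>{a..b}. f x * f x = 0"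
    by (subst (asm) integral_eq_0_iff) (use assms(1) in \<open>auto intro!: continuous_on_mult f\<close>)
  then show ?thesis using assms(4) by auto
qed

text \<open>With \<open>R\<close> an antiderivative of \<open>g\<close>, integration by parts makes
  \<open>f - R\<close> orthogonal to every admissible \<open>p'\<close>, that is, to every
  polynomial of mean zero. Hence \<open>f - R\<close> minus its mean \<open>c\<close> is orthogonal
  to all polynomials, and \<open>f = R + c\<close>.\<close>

lemma du_Bois_Reymond_polynomials:
  fixes f g :: "real \<Rightarrow> real"
  assumes "a < b" and f: "continuous_on {a..b} f" and g: "continuous_on {a..b} g"
    and weak: "\<And>p p'. \<lbrakk>real_polynomial_function p; p a = 0; p b = 0;
        \<And>t. (p has_real_derivative p' t) (at t); continuous_on {a..b} p'\<rbrakk>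
      \<Longrightarrow> integral {a..b} (\<lambda>t. f t * p' t + g t * p t) = 0"
    and "t \<in> {a..b}"
  shows "(f has_real_derivative g t) (at t within {a..b})"
proof -
  define R where "R = (\<lambda>x. integral {a..x} g)"
  have R': "(R has_real_derivative g x) (at x within {a..b})" if "x \<in> {a..b}" for x
    unfolding R_def using integral_has_real_derivative[OF g that] .
  have R: "continuous_on {a..b} R"
    using R' by (meson DERIV_continuous_on)
  define F where "F = (\<lambda>x. f x - R x)"
  have F: "continuous_on {a..b} F"
    unfolding F_def by (intro continuous_intros f R)
  define c where "c = integral {a..b} F / (b - a)"
  have F0: "continuous_on {a..b} (\<lambda>x. F x - c)"
    by (intro continuous_intros F)
  have int_F0: "integral {a..b} (\<lambda>x. F x - c) = 0"
    using assms(1) by (subst integral_diff) (auto simp: c_def intro!: integrable_continuous_real F)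
  have "integral {a..b} (\<lambda>x. (F x - c) * r x) = 0" if r: "real_polynomial_function r" for r
  proof -
    have cr: "continuous_on {a..b} r"
      using r by (auto intro!: continuous_on_polymonial_function simp: real_polynomial_function_eq)
    \<comment> \<open>Subtracting the mean makes an antiderivative take equal values at
      \<open>a\<close> and \<open>b\<close>; normalised at \<open>a\<close>, it is an admissible
      test function.\<close>
    define m where "m = integral {a..b} r / (b - a)"
    have "real_polynomial_function (\<lambda>x. r x - m)"
      using r by auto
    then obtain q where q: "real_polynomial_function q" "\<And>x. (q has_real_derivative r x - m) (at x)"
      using real_polynomial_function_antiderivative by blast
    define p where "p = (\<lambda>x. q x - q a)"
    have p: "real_polynomial_function p"
      unfolding p_def using q by auto
    have p': "(p has_real_derivative r x - m) (at x within S)" for x S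
      unfolding p_def by (auto intro!: derivative_eq_intros DERIV_subset[OF q(2)])
    have cp: "continuous_on {a..b} p"
      using p by (auto intro!: continuous_on_polymonial_function simp: real_polynomial_function_eq)
    have int_r: "integral {a..b} (\<lambda>x. r x - m) = 0"
      using assms(1) by (subst integral_diff) (auto simp: m_def intro!: integrable_continuous_real cr)
    have "((\<lambda>x. r x - m) has_integral p b - p a) {a..b}"
      using p' assms(1) by (intro fundamental_theorem_of_calculus)
        (auto simp: has_real_derivative_iff_has_vector_derivative[symmetric])
    then have pab: "p a = 0" "p b = 0"
      using int_r by (auto simp: p_def dest: integral_unique)
    \<comment> \<open>The integrand is the derivative of \<open>R * p\<close>, and the boundary
      terms vanish.\<close>
    have "((\<lambda>x. R x * (r x - m) + g x * p x) has_integral R b * p b - R a * p a) {a..b}"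
      using assms(1) by (intro fundamental_theorem_of_calculus)
        (auto simp: has_real_derivative_iff_has_vector_derivative[symmetric] intro!: derivative_eq_intros R' p')
    then have "integral {a..b} (\<lambda>x. R x * (r x - m) + g x * p x) = 0"
      using pab by (auto dest: integral_unique)
    moreover have "integral {a..b} (\<lambda>x. f x * (r x - m) + g x * p x) = 0"
      by (intro weak p pab p' continuous_intros cr)
    ultimately have "integral {a..b} (\<lambda>x. (f x * (r x - m) + g x * p x) - (R x * (r x - m) + g x * p x)) = 0"
      by (subst integral_diff) (auto intro!: integrable_continuous_real continuous_intros f g cr cp R)
    then have 1: "integral {a..b} (\<lambda>x. F x * (r x - m)) = 0"
      by (simp add: F_def algebra_simps)
    \<comment> \<open>The correction terms integrate to zero because \<open>F - c\<close> and
      \<open>r - m\<close> both have mean zero.\<close>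
    have "integral {a..b} (\<lambda>x. (F x - c) * r x)
        = integral {a..b} (\<lambda>x. F x * (r x - m) + (m * (F x - c) - c * (r x - m)))"
      by (rule integral_cong) (simp add: algebra_simps)
    also have "\<dots> = integral {a..b} (\<lambda>x. F x * (r x - m))
        + (integral {a..b} (\<lambda>x. m * (F x - c)) - integral {a..b} (\<lambda>x. c * (r x - m)))"
      by (simp add: integral_add integral_diff integrable_continuous_real continuous_intros F cr)
    also have "\<dots> = 0"
      using 1 int_F0 int_r by simp
    finally show ?thesis .
  qed
  then have "F x - c = 0" if "x \<in> {a..b}" for x
    using continuous_orthogonal_polynomials_eq_0[OF assms(1) F0 _ that] by blast
  then have "f x = R x + c" if "x \<in> {a..b}" for x
    using that by (simp add: F_def algebra_simps)
  moreover have "((\<lambda>x. R x + c) has_real_derivative g t) (at t within {a..b})"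
    by (auto intro!: derivative_eq_intros R' assms(5))
  ultimately show ?thesis
    using assms(5) by (auto intro: has_field_derivative_transform_within[where d = 1])
qed


section \<open>Partial derivatives\<close>

text \<open>The functionals \<open>blinfun_inner_left b\<close> form the dual basis. The expansion
  reduces continuity and differentiability in the dual space to real components.\<close>

lemma dual_expansion:
  fixes \<mu> :: "'a::euclidean_space \<Rightarrow>\<^sub>L real"
  shows "\<mu> = (\<Sum>b\<in>Basis. blinfun_apply \<mu> b *\<^sub>R blinfun_inner_left b)"
  by (rule blinfun_euclidean_eqI)
    (simp add: blinfun.sum_left blinfun.scaleR_left inner_Basis if_distrib cong: if_cong)

text \<open>Continuity of the derivative is stated for each fixed direction, the form in which
  \<open>Ck_on\<close> provides it; \<open>continuous_on_D_apply\<close> recovers joint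
  continuity.\<close>

locale C1_function =
  fixes E :: "'a::euclidean_space \<times> ('a \<Rightarrow>\<^sub>L real) \<Rightarrow> real" and D
  assumes has_derivative: "\<And>p. (E has_derivative D p) (at p)"
    and continuous_D: "\<And>v. continuous_on UNIV (\<lambda>p. D p v)"
begin

lemma bounded_linear_D: "bounded_linear (D p)"
  using has_derivative has_derivative_bounded_linear by blast

lemmas linear_D = bounded_linear_D[THEN bounded_linear.linear]

lemma partial_fst_apply: "blinfun_apply (partial_fst E x m) h = D (x, m) (h, 0)"
proof -
  have "((\<lambda>x. E (x, m)) has_derivative (\<lambda>h. D (x, m) (h, 0))) (at x)"
    by (rule has_derivative_compose[where f = "\<lambda>x. (x, m)" and g = E, OF _ has_derivative])
      (auto intro!: derivative_eq_intros)
  then have "frechet_derivative (\<lambda>x. E (x, m)) (at x) = (\<lambda>h. D (x, m) (h, 0))"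
    and "bounded_linear (\<lambda>h. D (x, m) (h, 0))"
    using frechet_derivative_at has_derivative_bounded_linear by metis+
  then show ?thesis
    by (simp add: partial_fst_def bounded_linear_Blinfun_apply)
qed

text \<open>A linear functional on the dual is evaluation at the vector whose coordinates are its
  values on the dual basis. This is existence for the \<open>THE\<close> in
  \<open>partial_snd\<close>; uniqueness follows by testing with inner products.\<close>

lemma partial_snd_expansion:
  "partial_snd E x m = (\<Sum>b\<in>Basis. D (x, m) (0, blinfun_inner_left b) *\<^sub>R b)" (is ?expansion)
  and apply_partial_snd: "blinfun_apply \<mu> (partial_snd E x m) = D (x, m) (0, \<mu>)"
proof -
  have "((\<lambda>m. E (x, m)) has_derivative (\<lambda>h. D (x, m) (0, h))) (at m)"
    by (rule has_derivative_compose[where f = "\<lambda>m. (x, m)" and g = E, OF _ has_derivative])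
      (auto intro!: derivative_eq_intros)
  then have fd: "frechet_derivative (\<lambda>m. E (x, m)) (at m) = (\<lambda>h. D (x, m) (0, h))"
    and bl: "bounded_linear (\<lambda>h. D (x, m) (0, h))"
    using frechet_derivative_at has_derivative_bounded_linear by metis+
  let ?v = "\<Sum>b\<in>Basis. D (x, m) (0, blinfun_inner_left b) *\<^sub>R b"
  interpret bounded_linear "\<lambda>h. D (x, m) (0, h)" by (fact bl)
  have v: "D (x, m) (0, \<mu>) = blinfun_apply \<mu> ?v" for \<mu>
    by (subst (1) dual_expansion[of \<mu>])
      (simp add: sum scaleR blinfun.sum_right blinfun.scaleR_right mult.commute)
  have "partial_snd E x m = ?v"
    unfolding partial_snd_def fd
  proof (rule the_equality)
    fix w assume w: "\<forall>\<mu>. D (x, m) (0, \<mu>) = blinfun_apply \<mu> w"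
    then have "b \<bullet> w = b \<bullet> ?v" for b
      using v[of "blinfun_inner_right b"] w by simp
    then show "w = ?v" by (meson vector_eq_ldot)
  qed (use v in blast)
  then show ?expansion "blinfun_apply \<mu> (partial_snd E x m) = D (x, m) (0, \<mu>)"
    using v[of \<mu>] by (simp_all only:)
qed

text \<open>Separates the direction from the base point: coordinates of \<open>v\<close> are
  multiplied by derivatives in fixed directions.\<close>

lemma D_expansion:
  "D p v = (\<Sum>b\<in>Basis. (fst v \<bullet> b) * D p (b, 0))
     + (\<Sum>b\<in>Basis. blinfun_apply (snd v) b * D p (0, blinfun_inner_left b))"
proof -
  interpret bounded_linear "D p" by (rule bounded_linear_D)
  have "v = (\<Sum>b\<in>Basis. (fst v \<bullet> b) *\<^sub>R (b, 0)) + (\<Sum>b\<in>Basis. blinfun_apply (snd v) b *\<^sub>R (0, blinfun_inner_left b))"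
    by (rule prod_eqI)
      (simp_all add: fst_sum snd_sum euclidean_representation flip: dual_expansion)
  then have "D p v = D p ((\<Sum>b\<in>Basis. (fst v \<bullet> b) *\<^sub>R (b, 0)) + (\<Sum>b\<in>Basis. blinfun_apply (snd v) b *\<^sub>R (0, blinfun_inner_left b)))"
    by simp
  then show ?thesis by (simp only: add sum scaleR real_scaleR_def)
qed

lemma continuous_on_D_apply:
  assumes "continuous_on S f" "continuous_on S g"
  shows "continuous_on S (\<lambda>x. D (f x) (g x))"
proof -
  have "continuous_on S (\<lambda>x. D (f x) v)" for v
    using continuous_on_compose2[OF continuous_D assms(1)] by auto
  then show ?thesis
    using assms(2) by (subst D_expansion) (intro continuous_intros)
qed

lemma continuous_on_partial_fst:
  assumes "continuous_on S f" "continuous_on S g"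
  shows "continuous_on S (\<lambda>x. partial_fst E (f x) (g x))"
  by (subst dual_expansion) (auto simp: partial_fst_apply intro!: continuous_intros continuous_on_D_apply assms)

lemma continuous_on_partial_snd:
  assumes "continuous_on S f" "continuous_on S g"
  shows "continuous_on S (\<lambda>x. partial_snd E (f x) (g x))"
  unfolding partial_snd_expansion by (auto intro!: continuous_intros continuous_on_D_apply assms)

text \<open>Differentiation under the integral sign; the joint continuity in
  \<open>\<epsilon>\<close> and \<open>t\<close> that it demands comes from
  \<open>continuous_on_D_apply\<close>.\<close>

lemma has_real_derivative_action:
  fixes \<gamma> w :: "real \<Rightarrow> 'a \<times> ('a \<Rightarrow>\<^sub>L real)"
  assumes \<gamma>: "continuous_on {a..b} \<gamma>" and w: "continuous_on {a..b} w"
  shows "((\<lambda>\<epsilon>. integral {a..b} (\<lambda>t. E (\<gamma> t + \<epsilon> *\<^sub>R w t))) has_real_derivative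
    integral {a..b} (\<lambda>t. D (\<gamma> t) (w t))) (at 0)"
proof -
  have cE: "continuous_on UNIV E"
    using has_derivative by (meson continuous_at_imp_continuous_on has_derivative_continuous)
  have "((\<lambda>\<epsilon>. integral (cbox a b) (\<lambda>t. E (\<gamma> t + \<epsilon> *\<^sub>R w t))) has_real_derivative
    integral (cbox a b) (\<lambda>t. D (\<gamma> t + 0 *\<^sub>R w t) (w t))) (at 0 within UNIV)"
  proof (rule leibniz_rule_field_derivative)
    fix \<epsilon> :: real and t
    have "((\<lambda>\<epsilon>. E (\<gamma> t + \<epsilon> *\<^sub>R w t)) has_derivative (\<lambda>h. D (\<gamma> t + \<epsilon> *\<^sub>R w t) (h *\<^sub>R w t))) (at \<epsilon>)"
      by (rule has_derivative_compose[where f = "\<lambda>\<epsilon>. \<gamma> t + \<epsilon> *\<^sub>R w t" and g = E, OF _ has_derivative])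
        (auto intro!: derivative_eq_intros)
    then show "((\<lambda>\<epsilon>. E (\<gamma> t + \<epsilon> *\<^sub>R w t)) has_real_derivative D (\<gamma> t + \<epsilon> *\<^sub>R w t) (w t)) (at \<epsilon> within UNIV)"
      by (simp add: has_field_derivative_def linear_scale[OF linear_D] mult.commute[of _ "D _ _"])
  next
    fix \<epsilon> :: real
    show "(\<lambda>t. E (\<gamma> t + \<epsilon> *\<^sub>R w t)) integrable_on cbox a b"
      by (intro integrable_continuous continuous_on_compose2[OF cE, where f = "\<lambda>t. \<gamma> t + \<epsilon> *\<^sub>R w t"]
          continuous_intros) (use assms in auto)
  next
    show "continuous_on (UNIV \<times> cbox a b) (\<lambda>(\<epsilon>, t). D (\<gamma> t + \<epsilon> *\<^sub>R w t) (w t))"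
      unfolding split_beta
      by (intro continuous_on_D_apply continuous_intros
          continuous_on_compose2[OF \<gamma>] continuous_on_compose2[OF w]) auto
  qed auto
  then show ?thesis by simp
qed

end

lemma smooth_on_UNIV_C1_function:
  assumes "smooth_on UNIV E"
  shows "C1_function E (\<lambda>p. frechet_derivative E (at p))"
proof
  have "Ck_on (Suc 0) UNIV E"
    using assms by (auto simp only: smooth_on_def)
  then show "(E has_derivative frechet_derivative E (at p)) (at p)"
    and "continuous_on UNIV (\<lambda>p. frechet_derivative E (at p) v)" for p v
    by (simp_all add: differentiable_on_def frechet_derivative_works del: split_paired_All)
qed


section \<open>The Euler-Poincare equations for an alternating bilinear bracket\<close>

locale alternating_bracket = bounded_bilinear br
  for br :: "'a::euclidean_space \<Rightarrow> 'a \<Rightarrow> 'a" +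
  assumes alternating: "br x x = 0"
begin

text \<open>Polarisation: \<open>br\<close> is expanded on the diagonal at
  \<open>x + y\<close>.\<close>

lemma antisymmetric: "br x y = - br y x"
proof -
  have "br x y + br y x = br (x + y) (x + y) - br x x - br y y"
    by (simp only: add_left add_right) simp
  then show ?thesis
    by (simp only: alternating diff_zero eq_neg_iff_add_eq_0)
qed

lemma ad_star_apply [simp]: "blinfun_apply (ad_star br x \<mu>) y = blinfun_apply \<mu> (br x y)"
  unfolding ad_star_def
  by (subst bounded_linear_Blinfun_apply)
    (auto intro!: bounded_linear_compose[OF blinfun.bounded_linear_right bounded_linear_right])

lemma continuous_on_ad_star:
  assumes "continuous_on S f" "continuous_on S g"
  shows "continuous_on S (\<lambda>t. ad_star br (f t) (g t))"
  by (subst dual_expansion)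
    (auto intro!: continuous_intros continuous_on assms)

section \<open>The first variation along a fixed curve\<close>

context
  fixes E :: "'a \<times> ('a \<Rightarrow>\<^sub>L real) \<Rightarrow> real" and D and a b :: real
    and \<xi> :: "real \<Rightarrow> 'a" and \<nu> :: "real \<Rightarrow> 'a \<Rightarrow>\<^sub>L real"
  assumes E: "C1_function E D" and ab: "a < b"
    and \<xi>: "continuous_on {a..b} \<xi>" and \<nu>: "continuous_on {a..b} \<nu>"
begin

interpretation C1_function E D by (fact E)

abbreviation (input) "P1 t \<equiv> partial_fst E (\<xi> t) (\<nu> t)"
abbreviation (input) "P2 t \<equiv> partial_snd E (\<xi> t) (\<nu> t)"
abbreviation (input) "Q1 t \<equiv> ad_star br (\<xi> t) (P1 t) - ad_star br (P2 t) (\<nu> t)"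
abbreviation (input) "Q2 t \<equiv> - br (\<xi> t) (P2 t)"

lemma continuous_P: "continuous_on {a..b} P1" "continuous_on {a..b} P2"
  by (intro continuous_on_partial_fst continuous_on_partial_snd \<xi> \<nu>)+

lemma continuous_Q: "continuous_on {a..b} Q1" "continuous_on {a..b} Q2"
  by (intro continuous_on_ad_star continuous_on continuous_P \<xi> \<nu> continuous_intros)+

text \<open>The terms without derivatives collect to the right-hand sides of the equations because
  \<open>\<nu> [\<eta>, v] = - \<nu> [v, \<eta>]\<close>.\<close>

lemma derivative_along_variation:
  "D (\<xi> t, \<nu> t) (s' + semidirect_bracket br (\<xi> t, \<nu> t) s) =
    (blinfun_apply (P1 t) (fst s') + blinfun_apply (Q1 t) (fst s)) +
    (blinfun_apply (snd s') (P2 t) + blinfun_apply (snd s) (Q2 t))"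
proof -
  have "D (\<xi> t, \<nu> t) w = blinfun_apply (P1 t) (fst w) + blinfun_apply (snd w) (P2 t)" for w
    using linear_add[OF linear_D, of "(\<xi> t, \<nu> t)" "(fst w, 0)" "(0, snd w)"]
    by (simp add: partial_fst_apply apply_partial_snd)
  then show ?thesis
    by (simp add: semidirect_bracket_def split_beta blinfun.add_right blinfun.add_left blinfun.diff_left
        blinfun.minus_right antisymmetric[of "fst s" "P2 t"])
qed

text \<open>The action always has a derivative along a variation, namely the integral of
  \<open>D\<close>. By uniqueness of derivatives, being extremal means that this integral
  vanishes.\<close>

lemma extremal_iff_first_variation:
  "extremal br E a b (\<lambda>t. (\<xi> t, \<nu> t)) \<longleftrightarrow>
    (\<forall>\<sigma>. smooth_on {a..b} \<sigma> \<and> \<sigma> a = 0 \<and> \<sigma> b = 0 \<longrightarrow>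
      integral {a..b} (\<lambda>t.
        (blinfun_apply (P1 t) (fst (vector_derivative \<sigma> (at t within {a..b})))
          + blinfun_apply (Q1 t) (fst (\<sigma> t))) +
        (blinfun_apply (snd (vector_derivative \<sigma> (at t within {a..b}))) (P2 t)
          + blinfun_apply (snd (\<sigma> t)) (Q2 t))) = 0)"
proof -
  have *: "((\<lambda>\<epsilon>. integral {a..b} (\<lambda>t. E ((\<xi> t, \<nu> t) + \<epsilon> *\<^sub>R
            (vector_derivative \<sigma> (at t within {a..b}) + semidirect_bracket br (\<xi> t, \<nu> t) (\<sigma> t)))))
          has_real_derivative 0) (at 0) \<longleftrightarrow>
        integral {a..b} (\<lambda>t. D (\<xi> t, \<nu> t)
          (vector_derivative \<sigma> (at t within {a..b}) + semidirect_bracket br (\<xi> t, \<nu> t) (\<sigma> t))) = 0"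
    (is "(?A has_real_derivative 0) _ \<longleftrightarrow> ?I = 0") if "smooth_on {a..b} \<sigma>" for \<sigma>
  proof -
    note \<sigma> = smooth_on_curve_C1[OF ab that]
    have A: "(?A has_real_derivative ?I) (at 0)"
    proof (rule has_real_derivative_action)
      show "continuous_on {a..b} (\<lambda>t. (\<xi> t, \<nu> t))"
        by (intro continuous_intros \<xi> \<nu>)
      show "continuous_on {a..b}
        (\<lambda>t. vector_derivative \<sigma> (at t within {a..b}) + semidirect_bracket br (\<xi> t, \<nu> t) (\<sigma> t))"
        unfolding semidirect_bracket_def split_beta fst_conv snd_conv
        by (intro continuous_on_add \<sigma>(2) continuous_on_Pair continuous_on_diff continuous_on_ad_star
            continuous_on \<xi> \<nu> continuous_on_fst continuous_on_snd \<sigma>(3))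
    qed
    show ?thesis
    proof
      show "?I = 0" if "(?A has_real_derivative 0) (at 0)"
        using DERIV_unique[OF A that] .
      show "(?A has_real_derivative 0) (at 0)" if "?I = 0"
        using A unfolding that .
    qed
  qed
  show ?thesis
    unfolding extremal_def derivative_along_variation[symmetric]
    by (rule iff_allI, rule imp_cong[OF refl], rule *, blast)
qed

text \<open>By the product rule and the equations, the integrand of the first variation is the
  derivative of \<open>?B\<close>, which vanishes at both end points together with
  \<open>\<sigma>\<close>.\<close>

lemma extremal_if_Euler_Poincare:
  assumes P1: "\<And>t. t \<in> {a..b} \<Longrightarrow> (P1 has_vector_derivative Q1 t) (at t within {a..b})"
    and P2: "\<And>t. t \<in> {a..b} \<Longrightarrow> (P2 has_vector_derivative Q2 t) (at t within {a..b})"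
  shows "extremal br E a b (\<lambda>t. (\<xi> t, \<nu> t))"
  unfolding extremal_iff_first_variation
proof (intro allI impI, elim conjE)
  fix \<sigma> :: "real \<Rightarrow> 'a \<times> ('a \<Rightarrow>\<^sub>L real)"
  assume smooth: "smooth_on {a..b} \<sigma>" and "\<sigma> a = 0" "\<sigma> b = 0"
  let ?\<sigma>' = "\<lambda>t. vector_derivative \<sigma> (at t within {a..b})"
  let ?I = "\<lambda>t. (blinfun_apply (P1 t) (fst (?\<sigma>' t)) + blinfun_apply (Q1 t) (fst (\<sigma> t))) +
    (blinfun_apply (snd (?\<sigma>' t)) (P2 t) + blinfun_apply (snd (\<sigma> t)) (Q2 t))"
  let ?B = "\<lambda>t. blinfun_apply (P1 t) (fst (\<sigma> t)) + blinfun_apply (snd (\<sigma> t)) (P2 t)"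
  have "(?B has_vector_derivative ?I t) (at t within {a..b})" if "t \<in> {a..b}" for t
  proof -
    note \<sigma> = smooth_on_curve_C1(1)[OF ab smooth that]
    note fst = bounded_linear.has_vector_derivative[OF bounded_linear_fst \<sigma>]
    note snd = bounded_linear.has_vector_derivative[OF bounded_linear_snd \<sigma>]
    from has_vector_derivative_add[OF blinfun.has_vector_derivative[OF P1[OF that] fst]
        blinfun.has_vector_derivative[OF snd P2[OF that]]]
    show ?thesis by (simp add: algebra_simps)
  qed
  then have "(?I has_integral ?B b - ?B a) {a..b}"
    using ab by (intro fundamental_theorem_of_calculus) auto
  then show "integral {a..b} ?I = 0"
    using \<open>\<sigma> a = 0\<close> \<open>\<sigma> b = 0\<close> by (auto dest: integral_unique)
qed

text \<open>The test curves are \<open>p t *\<^sub>R w\<close> with a polynomial \<open>p\<close>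
  and a fixed \<open>w\<close>. The choices \<open>w = (v, 0)\<close> and
  \<open>w = (0, \<mu>)\<close> separate the two equations and leave scalar instances of
  \<open>du_Bois_Reymond_polynomials\<close>.\<close>

lemma Euler_Poincare_if_extremal:
  assumes "extremal br E a b (\<lambda>t. (\<xi> t, \<nu> t))" and t: "t \<in> {a..b}"
  shows "(P1 has_vector_derivative Q1 t) (at t within {a..b})"
    and "(P2 has_vector_derivative Q2 t) (at t within {a..b})"
proof -
  have weak: "integral {a..b} (\<lambda>t.
      (p' t * blinfun_apply (P1 t) (fst w) + p t * blinfun_apply (Q1 t) (fst w)) +
      (p' t * blinfun_apply (snd w) (P2 t) + p t * blinfun_apply (snd w) (Q2 t))) = 0"
    if p: "real_polynomial_function p" "p a = 0" "p b = 0"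
      and p': "\<And>t. (p has_real_derivative p' t) (at t)" for p p' and w :: "'a \<times> ('a \<Rightarrow>\<^sub>L real)"
  proof -
    let ?\<sigma> = "\<lambda>t. p t *\<^sub>R w"
    have [simp]: "vector_derivative ?\<sigma> (at t within {a..b}) = p' t *\<^sub>R w" if "t \<in> {a..b}" for t
    proof (rule vector_derivative_within_cbox[of a b, unfolded box_real, OF ab])
      have "(p has_real_derivative p' t) (at t within {a..b})"
        using p' by (rule has_field_derivative_at_within)
      from has_vector_derivative_scaleR[OF this has_vector_derivative_const]
      show "(?\<sigma> has_vector_derivative p' t *\<^sub>R w) (at t within {a..b})" by simp
    qed (use that in auto)
    moreover have "smooth_on {a..b} ?\<sigma>"
      using smooth_on_polynomial_scaleR[OF ab p(1)] .
    moreover have "?\<sigma> a = 0" "?\<sigma> b = 0"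
      using p by auto
    ultimately show ?thesis
      by (intro trans[OF integral_cong assms(1)[unfolded extremal_iff_first_variation, rule_format, of ?\<sigma>]])
        (simp_all add: blinfun.scaleR_right blinfun.scaleR_left)
  qed
  have "((\<lambda>t. blinfun_apply (P1 t) v) has_real_derivative blinfun_apply (Q1 t) v) (at t within {a..b})" for v
  proof (rule du_Bois_Reymond_polynomials[OF ab _ _ _ t])
    fix p p' :: "real \<Rightarrow> real"
    assume "real_polynomial_function p" "p a = 0" "p b = 0" "\<And>t. (p has_real_derivative p' t) (at t)"
    from weak[OF this, of "(v, 0)"]
    show "integral {a..b} (\<lambda>t. blinfun_apply (P1 t) v * p' t + blinfun_apply (Q1 t) v * p t) = 0"
      by (simp add: mult.commute)
  qed (intro continuous_intros continuous_P continuous_Q)+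
  from has_vector_derivative_scaleR[OF this has_vector_derivative_const]
  \<comment> \<open>The scalar derivatives are reassembled through
    \<open>dual_expansion\<close>.\<close>
  have "((\<lambda>t. \<Sum>v\<in>Basis. blinfun_apply (P1 t) v *\<^sub>R blinfun_inner_left v) has_vector_derivative
      (\<Sum>v\<in>Basis. blinfun_apply (Q1 t) v *\<^sub>R blinfun_inner_left v)) (at t within {a..b})"
    by (intro has_vector_derivative_sum) (simp only: scaleR_zero_right add_0)
  then show "(P1 has_vector_derivative Q1 t) (at t within {a..b})"
    by (simp only: flip: dual_expansion)
  have "((\<lambda>t. blinfun_apply \<mu> (P2 t)) has_real_derivative blinfun_apply \<mu> (Q2 t)) (at t within {a..b})" for \<mu>
  proof (rule du_Bois_Reymond_polynomials[OF ab _ _ _ t])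
    fix p p' :: "real \<Rightarrow> real"
    assume "real_polynomial_function p" "p a = 0" "p b = 0" "\<And>t. (p has_real_derivative p' t) (at t)"
    from weak[OF this, of "(0, \<mu>)"]
    show "integral {a..b} (\<lambda>t. blinfun_apply \<mu> (P2 t) * p' t + blinfun_apply \<mu> (Q2 t) * p t) = 0"
      by (simp add: mult.commute)
  qed (intro continuous_intros continuous_P continuous_Q)+
  from has_vector_derivative_scaleR[OF this has_vector_derivative_const]
  have "((\<lambda>t. \<Sum>v\<in>Basis. blinfun_apply (blinfun_inner_left v) (P2 t) *\<^sub>R v) has_vector_derivative
      (\<Sum>v\<in>Basis. blinfun_apply (blinfun_inner_left v) (Q2 t) *\<^sub>R v)) (at t within {a..b})"
    by (intro has_vector_derivative_sum) (simp only: scaleR_zero_right add_0)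
  then show "(P2 has_vector_derivative Q2 t) (at t within {a..b})"
    by (simp only: blinfun_inner_left.rep_eq euclidean_representation)
qed

end

end


section \<open>Picard-Lindeloef for globally Lipschitz vector fields\<close>

text \<open>Banach's fixed point theorem for bounded continuous functions on the whole line. As the
  Lipschitz bound is global, the solution need not be confined to a ball.\<close>

lemma Picard_Lindeloef_global:
  fixes f :: "'a::euclidean_space \<Rightarrow> 'a"
  assumes f: "L-lipschitz_on UNIV f"
  obtains \<delta> x where "\<delta> > 0" "x 0 = x0"
    "\<And>t. t \<in> {-\<delta><..<\<delta>} \<Longrightarrow> (x has_vector_derivative f (x t)) (at t)"
proof -
  have L: "L \<ge> 0" and lip: "norm (f u - f v) \<le> L * norm (u - v)" for u v
    using f by (auto simp: lipschitz_on_def dist_norm)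
  have cf: "continuous_on UNIV f"
    using f by (rule lipschitz_on_continuous_on)
  \<comment> \<open>Two differences of \<open>J\<close> each contribute
    \<open>2 * \<delta> * L\<close> to the contraction constant, and their sum must be at most
    1/2.\<close>
  define \<delta> where "\<delta> = 1 / (8 * (L + 1))"
  have \<delta>: "\<delta> > 0" "4 * \<delta> * L \<le> 1 / 2"
    using L by (auto simp: \<delta>_def field_simps)
  \<comment> \<open>Integrating from \<open>-\<delta>\<close> treats both signs of \<open>t\<close>
    with one formula; subtracting \<open>J x 0\<close> in \<open>F\<close> restores the initial
    value at \<open>0\<close>.\<close>
  define J where "J = (\<lambda>(x :: real \<Rightarrow>\<^sub>C 'a) t. integral {-\<delta>..t} (\<lambda>s. f (x s)))"
  \<comment> \<open>Clamping the time makes \<open>F x\<close> bounded and continuous on the whole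
    line.\<close>
  define c where "c = (\<lambda>t::real. max (-\<delta>) (min \<delta> t))"
  have c: "c t \<in> {-\<delta>..\<delta>}" for t
    using \<delta> by (auto simp: c_def)
  have cont: "continuous_on S (\<lambda>s. f (apply_bcontfun x s))" for S and x :: "real \<Rightarrow>\<^sub>C 'a"
    by (rule continuous_on_compose2[OF cf]) auto
  have J': "(J x has_vector_derivative f (x t)) (at t within {-\<delta>..\<delta>})" if "t \<in> {-\<delta>..\<delta>}" for x t
    unfolding J_def by (rule integral_has_vector_derivative[OF cont that])
  define F where "F = (\<lambda>x t. x0 + J x (c t) - J x 0)"
  have F: "F x \<in> bcontfun" for x
  proof -
    have J: "continuous_on {-\<delta>..\<delta>} (J x)"
      using J' by (intro continuous_on_vector_derivative) blast
    have "continuous_on UNIV c"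
      unfolding c_def by (intro continuous_intros)
    then have "continuous_on UNIV (F x)"
      unfolding F_def using c by (intro continuous_intros continuous_on_compose2[OF J]) auto
    moreover have "bounded ((\<lambda>t. x0 + J x t - J x 0) ` {-\<delta>..\<delta>})"
      by (intro compact_imp_bounded compact_continuous_image continuous_intros J) auto
    then have "bounded (range (F x))"
      by (rule bounded_subset) (use c in \<open>auto simp: F_def\<close>)
    ultimately show ?thesis by (simp add: bcontfun_def)
  qed
  have J_diff: "norm (J x t - J y t) \<le> 2 * \<delta> * L * dist x y" if "t \<in> {-\<delta>..\<delta>}" for x y t
  proof -
    have "J x t - J y t = integral {-\<delta>..t} (\<lambda>s. f (x s) - f (y s))"
      unfolding J_def by (intro integral_diff[symmetric] integrable_continuous_real cont)
    also have "norm \<dots> \<le> (L * dist x y) * (t - (-\<delta>))"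
    proof (rule integral_bound)
      fix s
      have "L * norm (x s - y s) \<le> L * dist x y"
        using dist_bounded[of x s y] L by (intro mult_left_mono) (simp_all add: dist_norm)
      then show "norm (f (x s) - f (y s)) \<le> L * dist x y"
        using lip order_trans by blast
    qed (use that cont in \<open>auto intro!: continuous_intros\<close>)
    also have "\<dots> \<le> (L * dist x y) * (2 * \<delta>)"
      using that L by (intro mult_left_mono) auto
    finally show ?thesis by (simp add: mult_ac)
  qed
  have "dist (Bcontfun (F x)) (Bcontfun (F y)) \<le> 1 / 2 * dist x y" for x y
  proof (rule dist_bound)
    fix t
    have "norm (F x t - F y t) = norm ((J x (c t) - J y (c t)) - (J x 0 - J y 0))"
      by (simp add: F_def algebra_simps)
    also have "\<dots> \<le> norm (J x (c t) - J y (c t)) + norm (J x 0 - J y 0)"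
      by (rule norm_triangle_ineq4)
    also have "\<dots> \<le> 2 * \<delta> * L * dist x y + 2 * \<delta> * L * dist x y"
      using c \<delta> by (intro add_mono J_diff) auto
    also have "\<dots> = (4 * \<delta> * L) * dist x y" by simp
    also have "\<dots> \<le> 1 / 2 * dist x y"
      using \<delta> by (intro mult_right_mono) auto
    finally show "dist (Bcontfun (F x) t) (Bcontfun (F y) t) \<le> 1 / 2 * dist x y"
      by (simp add: Bcontfun_inverse F dist_norm)
  qed
  then have "\<exists>!x. Bcontfun (F x) = x"
    by (intro banach_fix_type[of "1/2"]) auto
  then obtain x where "Bcontfun (F x) = x" by blast
  then have x: "apply_bcontfun x = F x"
    using Bcontfun_inverse[OF F] by metis
  show ?thesis
  proof
    show "\<delta> > 0" by (fact \<delta>)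
    show "x 0 = x0"
      using \<delta> by (subst x) (simp add: F_def c_def)
    fix t assume t: "t \<in> {-\<delta><..<\<delta>}"
    then have "(J x has_vector_derivative f (x t)) (at t)"
      using J'[of t x] at_within_Icc_at[of "-\<delta>" t \<delta>] by auto
    then have "((\<lambda>t. x0 + J x t - J x 0) has_vector_derivative f (x t)) (at t)"
      by (auto intro!: derivative_eq_intros)
    then show "(x has_vector_derivative f (x t)) (at t)"
    proof (rule has_vector_derivative_transform_within_open[OF _ _ t])
      fix s assume "s \<in> {-\<delta><..<\<delta>}"
      then show "x0 + J x s - J x 0 = x s"
        by (subst x) (simp add: F_def c_def)
    qed auto
  qed
qed


section \<open>Lie groups in a chart around the unit element\<close>

text \<open>At points of the open set \<open>S\<close> the derivative within \<open>S\<close> is the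
  ordinary one. The two agree only there, so the second derivatives are compared by transfer on the
  open set \<open>S\<close>.\<close>

lemma smooth_on_open_C2:
  assumes "open S" "smooth_on S f"
  shows "p \<in> S \<Longrightarrow> (f has_derivative frechet_derivative f (at p)) (at p)"
    and "p \<in> S \<Longrightarrow> (\<lambda>p. frechet_derivative f (at p) v) differentiable (at p)"
    and "continuous_on S (\<lambda>p. frechet_derivative (\<lambda>p. frechet_derivative f (at p) v) (at p) w)"
proof -
  have C: "Ck_on (Suc (Suc 0)) S f"
    using assms(2) unfolding smooth_on_def by blast
  show "(f has_derivative frechet_derivative f (at p)) (at p)" if "p \<in> S"
  proof -
    have "f differentiable at p within S"
      using C that by (simp add: differentiable_on_def)
    then show ?thesis
      using frechet_derivative_works at_within_open[OF that assms(1)] by metis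
  qed
  let ?D = "\<lambda>p. frechet_derivative f (at p within S) v"
  have D: "?D p = frechet_derivative f (at p) v" if "p \<in> S" for p
    by (simp add: at_within_open[OF that assms(1)])
  have "?D differentiable (at p)" if "p \<in> S" for p
    using C that by (simp add: differentiable_on_def flip: at_within_open[OF that assms(1)])
  then have D_has: "(?D has_derivative frechet_derivative ?D (at p)) (at p)" if "p \<in> S" for p
    using that frechet_derivative_works by blast
  have D'_has: "((\<lambda>p. frechet_derivative f (at p) v) has_derivative frechet_derivative ?D (at p)) (at p)"
    if "p \<in> S" for p
    by (rule has_derivative_transform_within_open[OF D_has[OF that] assms(1) that D])
  then show "(\<lambda>p. frechet_derivative f (at p) v) differentiable (at p)" if "p \<in> S"
    using that differentiable_def by blast
  have eq: "frechet_derivative ?D (at p within S) w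
      = frechet_derivative (\<lambda>p. frechet_derivative f (at p) v) (at p) w" if "p \<in> S" for p
    using frechet_derivative_at[OF D'_has[OF that]] by (simp add: at_within_open[OF that assms(1)])
  have "continuous_on S (\<lambda>p. frechet_derivative ?D (at p within S) w)"
    using C by simp
  then show "continuous_on S (\<lambda>p. frechet_derivative (\<lambda>p. frechet_derivative f (at p) v) (at p) w)"
    by (rule continuous_on_eq) (rule eq)
qed

text \<open>Mean value inequality: the operator norm is at most the sum of the norms on the basis
  vectors, which is continuous and hence bounded on \<open>S\<close>.\<close>

lemma C1_lipschitz_on_compact_convex:
  fixes f :: "'a::euclidean_space \<Rightarrow> 'b::real_normed_vector"
  assumes "compact S" "convex S"
    and f': "\<And>x. x \<in> S \<Longrightarrow> (f has_derivative f' x) (at x)"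
    and cont: "\<And>v. continuous_on S (\<lambda>x. f' x v)"
  obtains L where "L-lipschitz_on S f"
proof -
  have "bounded ((\<lambda>x. \<Sum>b\<in>Basis. norm (f' x b)) ` S)"
    by (intro compact_imp_bounded compact_continuous_image continuous_intros cont assms)
  then obtain B where B: "B > 0" "\<And>x. x \<in> S \<Longrightarrow> \<bar>\<Sum>b\<in>Basis. norm (f' x b)\<bar> \<le> B"
    unfolding bounded_pos by auto
  have "norm (f x - f y) \<le> B * norm (x - y)" if "x \<in> S" "y \<in> S" for x y
  proof (rule differentiable_bound[OF assms(2) _ _ that])
    fix z assume z: "z \<in> S"
    show "(f has_derivative f' z) (at z within S)"
      using f'[OF z] by (rule has_derivative_at_withinI)
    show "onorm (f' z) \<le> B"
      using onorm_componentwise[OF has_derivative_bounded_linear[OF f'[OF z]]] B(2)[OF z] by linarith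
  qed
  then have "B-lipschitz_on S f"
    using B(1) by (auto intro!: lipschitz_onI simp: dist_norm)
  then show ?thesis by (rule that)
qed

locale lie_group_chart = lie_group G T atlas
  for G (structure)
    and T :: "'g topology"
    and atlas :: "('g set \<times> ('g \<Rightarrow> 'a::euclidean_space)) set" +
  fixes U \<phi>
  assumes chart: "(U, \<phi>) \<in> atlas"
    and one_in_U: "\<one> \<in> U"
begin

abbreviation \<psi> where "\<psi> \<equiv> inv_into U \<phi>"
abbreviation e where "e \<equiv> \<phi> \<one>"

text \<open>The group law in coordinates; it is meaningful on \<open>mul_dom\<close>, which is
  open.\<close>

definition mul where "mul p = \<phi> (\<psi> (fst p) \<otimes> \<psi> (snd p))"
definition mul_dom where "mul_dom = {p. fst p \<in> \<phi> ` U \<and> snd p \<in> \<phi> ` U \<and> \<psi> (fst p) \<otimes> \<psi> (snd p) \<in> U}"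
definition iv where "iv x = \<phi> (inv (\<psi> x))"
definition iv_dom where "iv_dom = {x. x \<in> \<phi> ` U \<and> inv (\<psi> x) \<in> U}"
definition dm where "dm p = frechet_derivative mul (at p)"

section \<open>The chart and continuous maps into the group\<close>

lemma U_subset: "g \<in> U \<Longrightarrow> g \<in> carrier G"
  using chart_domain[OF chart] openin_subset topspace_carrier by blast

lemma inj_on_U: "inj_on \<phi> U"
  using homeomorphic_imp_injective_map[OF chart_homeomorphic[OF chart]] U_subset
  by (simp add: topspace_carrier Int_absorb1 subsetI)

lemma \<psi>_\<phi> [simp]: "g \<in> U \<Longrightarrow> \<psi> (\<phi> g) = g"
  using inj_on_U by simp

lemma \<phi>_\<psi> [simp]: "x \<in> \<phi> ` U \<Longrightarrow> \<phi> (\<psi> x) = x"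
  by (rule f_inv_into_f)

lemma \<psi>_in [simp]: "x \<in> \<phi> ` U \<Longrightarrow> \<psi> x \<in> U"
  by (rule inv_into_into)

lemma \<psi>_carrier [simp]: "x \<in> \<phi> ` U \<Longrightarrow> \<psi> x \<in> carrier G"
  using U_subset by simp

lemma open_image: "open (\<phi> ` U)"
  using chart_image[OF chart] .

lemma e_in [simp]: "e \<in> \<phi> ` U"
  using one_in_U by simp

text \<open>The continuous inverse supplied by the homeomorphism agrees with \<open>inv_into\<close>
  on the image of the chart.\<close>

lemma continuous_map_\<psi>: "continuous_map (top_of_set (\<phi> ` U)) T \<psi>"
proof -
  obtain g where g: "homeomorphic_maps (subtopology T U) (top_of_set (\<phi> ` U)) \<phi> g"
    using chart_homeomorphic[OF chart] homeomorphic_map_maps by blast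
  then have "continuous_map (top_of_set (\<phi> ` U)) T g"
    by (auto simp: homeomorphic_maps_def continuous_map_in_subtopology)
  moreover have "g x = \<psi> x" if "x \<in> \<phi> ` U" for x
    using g that U_subset by (auto simp: homeomorphic_maps_def topspace_carrier)
  ultimately show ?thesis
    by (auto intro: continuous_map_eq)
qed

lemma continuous_map_mult:
  assumes "continuous_map X T f" "continuous_map X T g"
  shows "continuous_map X T (\<lambda>x. f x \<otimes> g x)"
proof -
  have "continuous_map X T ((\<lambda>(g, h). g \<otimes> h) \<circ> (\<lambda>x. (f x, g x)))"
    by (rule continuous_map_compose[OF _ continuous_mult]) (simp add: assms continuous_map_pairedI)
  then show ?thesis by (simp add: o_def)
qed

lemma continuous_map_inv: "continuous_map X T f \<Longrightarrow> continuous_map X T (\<lambda>x. inv (f x))"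
  using continuous_map_compose[OF _ continuous_inverse, of X f] by (simp add: o_def)

lemma continuous_map_carrier: "continuous_map (top_of_set S) T f \<Longrightarrow> x \<in> S \<Longrightarrow> f x \<in> carrier G"
  using continuous_map_image_subset_topspace topspace_carrier by fastforce

lemma continuous_map_const_carrier: "g \<in> carrier G \<Longrightarrow> continuous_map X T (\<lambda>_. g)"
  by (simp add: topspace_carrier)

lemma continuous_map_reparam:
  assumes "continuous_map (top_of_set S) T f" "continuous_on S' h" "h ` S' \<subseteq> S"
  shows "continuous_map (top_of_set S') T (\<lambda>x. f (h x))"
  using continuous_map_compose[of "top_of_set S'" "top_of_set S" h T f] assms
  by (auto simp: o_def)

lemma open_preimage:
  assumes "continuous_map (top_of_set S) T f" "open S" "openin T A"
  shows "open {x \<in> S. f x \<in> A}"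
  using openin_continuous_map_preimage[OF assms(1,3)] openin_open_eq[OF assms(2)] by simp

lemma open_preimage_U:
  assumes "continuous_map (top_of_set S) T f" "open S"
  shows "open {x \<in> S. f x \<in> U}"
  using open_preimage[OF assms chart_domain[OF chart]] .

section \<open>The group operations in coordinates\<close>

lemma open_mul_dom: "open mul_dom"
proof -
  let ?S = "\<phi> ` U \<times> \<phi> ` U"
  have "continuous_map (top_of_set ?S) T (\<lambda>p. \<psi> (fst p) \<otimes> \<psi> (snd p))"
    by (intro continuous_map_mult continuous_map_reparam[OF continuous_map_\<psi>] continuous_intros) auto
  from open_preimage_U[OF this] have "open {p \<in> ?S. \<psi> (fst p) \<otimes> \<psi> (snd p) \<in> U}"
    using open_image open_Times by blast
  then show ?thesis
    by (rule back_subst[of "open"]) (auto simp: mul_dom_def)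
qed

lemma open_iv_dom: "open iv_dom"
  using open_preimage_U[OF continuous_map_inv[OF continuous_map_\<psi>] open_image]
  by (simp add: iv_dom_def Collect_conj_eq)

lemma mul_C2:
  "p \<in> mul_dom \<Longrightarrow> (mul has_derivative dm p) (at p)"
  "p \<in> mul_dom \<Longrightarrow> (\<lambda>p. dm p v) differentiable (at p)"
  "continuous_on mul_dom (\<lambda>p. frechet_derivative (\<lambda>p. dm p v) (at p) w)"
proof -
  have "mul_dom = {(x, y). x \<in> \<phi> ` U \<and> y \<in> \<phi> ` U \<and> \<psi> x \<otimes> \<psi> y \<in> U}"
    "mul = (\<lambda>(x, y). \<phi> (\<psi> x \<otimes> \<psi> y))"
    by (auto simp: mul_dom_def mul_def)
  then have "smooth_on mul_dom mul"
    using smooth_mult[OF chart chart chart] by simp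
  note C2 = smooth_on_open_C2[OF open_mul_dom this, folded dm_def]
  show "p \<in> mul_dom \<Longrightarrow> (mul has_derivative dm p) (at p)"
    "p \<in> mul_dom \<Longrightarrow> (\<lambda>p. dm p v) differentiable (at p)"
    "continuous_on mul_dom (\<lambda>p. frechet_derivative (\<lambda>p. dm p v) (at p) w)"
    by (fact C2)+
qed

lemma linear_dm: "p \<in> mul_dom \<Longrightarrow> linear (dm p)"
  using mul_C2(1) has_derivative_linear by blast

lemma iv_differentiable: "x \<in> iv_dom \<Longrightarrow> iv differentiable (at x)"
proof -
  have "smooth_on iv_dom iv"
    using smooth_inverse[OF chart chart] unfolding iv_dom_def iv_def .
  from smooth_on_open_C2(1)[OF open_iv_dom this]
  show "x \<in> iv_dom \<Longrightarrow> iv differentiable (at x)"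
    using differentiable_def by blast
qed

lemma mul_has_derivative:
  assumes "(f has_derivative f') (at x within S)" "(g has_derivative g') (at x within S)"
    and "(f x, g x) \<in> mul_dom"
  shows "((\<lambda>x. mul (f x, g x)) has_derivative (\<lambda>h. dm (f x, g x) (f' h, g' h))) (at x within S)"
  by (rule has_derivative_compose[OF has_derivative_Pair[OF assms(1,2)] mul_C2(1)[OF assms(3)]])

lemma mul_\<phi>: "g \<in> U \<Longrightarrow> h \<in> U \<Longrightarrow> mul (\<phi> g, \<phi> h) = \<phi> (g \<otimes> h)"
  by (simp add: mul_def)

lemma \<phi>_in_mul_dom: "g \<in> U \<Longrightarrow> h \<in> U \<Longrightarrow> g \<otimes> h \<in> U \<Longrightarrow> (\<phi> g, \<phi> h) \<in> mul_dom"
  by (simp add: mul_dom_def)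

lemma \<phi>_in_iv_dom: "g \<in> U \<Longrightarrow> inv g \<in> U \<Longrightarrow> \<phi> g \<in> iv_dom"
  by (simp add: iv_dom_def)

lemma in_mul_dom:
  shows "x \<in> \<phi> ` U \<Longrightarrow> (x, e) \<in> mul_dom" and "x \<in> iv_dom \<Longrightarrow> (iv x, x) \<in> mul_dom"
  by (auto simp: mul_dom_def iv_dom_def iv_def one_in_U U_subset)

lemma e_in_iv_dom: "e \<in> iv_dom"
  by (simp add: iv_dom_def one_in_U)

lemma iv_e: "iv e = e"
  by (simp add: iv_def one_in_U)

lemma iv_in: "x \<in> iv_dom \<Longrightarrow> iv x \<in> \<phi> ` U"
  by (auto simp: iv_dom_def iv_def)

section \<open>Derivatives of the group identities\<close>

lemma dm_left_unit: "dm (e, e) (0, v) = v"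
proof -
  have "((\<lambda>x. mul (e, x)) has_derivative (\<lambda>h. dm (e, e) (0, h))) (at e)"
    using mul_has_derivative[OF has_derivative_const has_derivative_ident] in_mul_dom(1) by simp
  moreover have "((\<lambda>x. mul (e, x)) has_derivative (\<lambda>h. h)) (at e)"
    by (rule has_derivative_transform_within_open[OF has_derivative_ident open_image])
      (auto simp: mul_def one_in_U U_subset)
  ultimately have "(\<lambda>h. dm (e, e) (0, h)) = (\<lambda>h. h)"
    by (rule has_derivative_unique)
  then show ?thesis by (rule fun_cong)
qed

text \<open>Differentiates \<open>x \<otimes> inv x = \<one>\<close> at the unit element.\<close>

lemma dm_inverse:
  assumes "(iv has_derivative iv') (at e)"
  shows "dm (e, e) (v, iv' v) = 0"
proof -
  have "((\<lambda>x. mul (x, iv x)) has_derivative (\<lambda>h. dm (e, e) (h, iv' h))) (at e)"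
    using mul_has_derivative[OF has_derivative_ident assms] in_mul_dom(1) by (simp add: iv_e)
  moreover have "((\<lambda>x. mul (x, iv x)) has_derivative (\<lambda>h. 0)) (at e)"
    by (rule has_derivative_transform_within_open[OF has_derivative_const[of e] open_iv_dom e_in_iv_dom])
      (auto simp: mul_def iv_def iv_dom_def U_subset)
  ultimately have "(\<lambda>h. dm (e, e) (h, iv' h)) = (\<lambda>h. 0)"
    by (rule has_derivative_unique)
  then show ?thesis by (rule fun_cong)
qed

text \<open>Differentiates \<open>inv x \<otimes> (x \<otimes> z) = z\<close> at the unit element:
  translation by the inverse carries the left invariant vector field at \<open>x\<close> back to its
  value at \<open>e\<close>.\<close>

lemma dm_iv_dm:
  assumes x: "x \<in> iv_dom"
  shows "dm (iv x, x) (0, dm (x, e) (0, v)) = v"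
proof -
  have x_in: "x \<in> \<phi> ` U" using x by (simp add: iv_dom_def)
  have x_e: "mul (x, e) = x" using x_in by (simp add: mul_def one_in_U)
  have "((\<lambda>z. mul (x, z)) has_derivative (\<lambda>h. dm (x, e) (0, h))) (at e)"
    using mul_has_derivative[OF has_derivative_const has_derivative_ident] in_mul_dom(1)[OF x_in] by simp
  from mul_has_derivative[OF has_derivative_const[of "iv x"] this]
  have "((\<lambda>z. mul (iv x, mul (x, z))) has_derivative (\<lambda>h. dm (iv x, x) (0, dm (x, e) (0, h)))) (at e)"
    using in_mul_dom(2)[OF x] by (simp add: x_e)
  moreover have "((\<lambda>z. mul (iv x, mul (x, z))) has_derivative (\<lambda>h. h)) (at e)"
  proof (rule has_derivative_transform_within_open[OF has_derivative_ident])
    show "open {z \<in> \<phi> ` U. \<psi> x \<otimes> \<psi> z \<in> U}"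
      using x_in by (intro open_preimage_U continuous_map_mult continuous_map_const_carrier
          continuous_map_\<psi> open_image) auto
    show "e \<in> {z \<in> \<phi> ` U. \<psi> x \<otimes> \<psi> z \<in> U}"
      using x_in by (simp add: one_in_U)
    fix z assume "z \<in> {z \<in> \<phi> ` U. \<psi> x \<otimes> \<psi> z \<in> U}"
    then show "z = mul (iv x, mul (x, z))"
      using x by (simp add: mul_def iv_def iv_dom_def flip: m_assoc)
  qed
  ultimately have "(\<lambda>h. dm (iv x, x) (0, dm (x, e) (0, h))) = (\<lambda>h. h)"
    by (rule has_derivative_unique)
  then show ?thesis by (rule fun_cong)
qed

text \<open>Left translation by \<open>g\<close> followed by right translation by \<open>h\<close>,
  each read in the chart. Conjugation is the case where \<open>g\<close> is the inverse of
  \<open>h\<close>.\<close>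

lemma has_derivative_translation:
  assumes "g \<in> U" "h \<in> U" "g \<otimes> h \<in> U"
  shows "((\<lambda>x. \<phi> (g \<otimes> \<psi> x \<otimes> h)) has_derivative (\<lambda>v. dm (\<phi> g, \<phi> h) (dm (\<phi> g, e) (0, v), 0))) (at e)"
proof (rule has_derivative_transform_within_open)
  have "((\<lambda>x. mul (\<phi> g, x)) has_derivative (\<lambda>v. dm (\<phi> g, e) (0, v))) (at e)"
    using mul_has_derivative[OF has_derivative_const has_derivative_ident] in_mul_dom(1) assms by simp
  from mul_has_derivative[OF this has_derivative_const[of "\<phi> h"]]
  show "((\<lambda>x. mul (mul (\<phi> g, x), \<phi> h)) has_derivative
      (\<lambda>v. dm (\<phi> g, \<phi> h) (dm (\<phi> g, e) (0, v), 0))) (at e)"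
    using assms U_subset \<phi>_in_mul_dom by (simp add: mul_\<phi> one_in_U)
  show "open {x \<in> \<phi> ` U. g \<otimes> \<psi> x \<in> U}"
    using assms U_subset by (intro open_preimage_U continuous_map_mult continuous_map_const_carrier
        continuous_map_\<psi> open_image) auto
  show "e \<in> {x \<in> \<phi> ` U. g \<otimes> \<psi> x \<in> U}"
    using assms U_subset by (simp add: one_in_U)
  fix x assume "x \<in> {x \<in> \<phi> ` U. g \<otimes> \<psi> x \<in> U}"
  then show "mul (mul (\<phi> g, x), \<phi> h) = \<phi> (g \<otimes> \<psi> x \<otimes> h)"
    using assms by (simp add: mul_def)
qed

subsection \<open>Left logarithmic derivatives\<close>

text \<open>The translated curve passes through the unit element at \<open>h = 0\<close>, so one
  chart serves at every \<open>t\<close>, even when \<open>y t\<close> lies outside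
  \<open>U\<close>.\<close>

definition has_left_log_derivative :: "(real \<Rightarrow> 'g) \<Rightarrow> 'a \<Rightarrow> real \<Rightarrow> bool" where
  "has_left_log_derivative y \<xi> t \<longleftrightarrow>
     ((\<lambda>h. \<phi> (inv (y t) \<otimes> y (t + h))) has_vector_derivative \<xi>) (at 0)"

text \<open>Near \<open>t\<close> the quotient at \<open>t + h\<close> is \<open>y1 t \<otimes> (u h
  \<otimes> inv (v h)) \<otimes> inv (y2 t)\<close>, where \<open>u\<close> and \<open>v\<close>
  start at the unit element with the same velocity \<open>\<xi>\<close>. So the middle factor, and
  with it the quotient, has derivative zero.\<close>

lemma quotient_constant:
  assumes I: "open I" "connected I"
    and y1: "continuous_map (top_of_set I) T y1" "\<And>t. t \<in> I \<Longrightarrow> has_left_log_derivative y1 \<xi> t"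
    and y2: "continuous_map (top_of_set I) T y2" "\<And>t. t \<in> I \<Longrightarrow> has_left_log_derivative y2 \<xi> t"
    and U: "\<And>t. t \<in> I \<Longrightarrow> y1 t \<in> U" "\<And>t. t \<in> I \<Longrightarrow> inv (y2 t) \<in> U"
      "\<And>t. t \<in> I \<Longrightarrow> y1 t \<otimes> inv (y2 t) \<in> U"
    and "s \<in> I" "t \<in> I"
  shows "y1 s \<otimes> inv (y2 s) = y1 t \<otimes> inv (y2 t)"
proof -
  let ?d = "\<lambda>t. y1 t \<otimes> inv (y2 t)"
  have "((\<lambda>t. \<phi> (?d t)) has_derivative (\<lambda>h. 0)) (at t)" if t: "t \<in> I" for t
  proof -
    define S where "S = {h. t + h \<in> I}"
    have S: "open S" "0 \<in> S"
      using open_vimage[OF I(1), of "(+) t"] t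
      by (auto simp: S_def vimage_def continuous_on_add)
    have carr: "y1 s \<in> carrier G" "y2 s \<in> carrier G" if "s \<in> I" for s
      using continuous_map_carrier y1 y2 that by blast+
    define u where "u = (\<lambda>h. inv (y1 t) \<otimes> y1 (t + h))"
    define v where "v = (\<lambda>h. inv (y2 t) \<otimes> y2 (t + h))"
    have cu: "continuous_map (top_of_set S) T u" and cv: "continuous_map (top_of_set S) T v"
      unfolding u_def v_def using carr[OF t]
      by (intro continuous_map_mult continuous_map_const_carrier inv_closed
          continuous_map_reparam[OF y1(1)] continuous_map_reparam[OF y2(1)] continuous_intros;
          auto simp: S_def)+
    \<comment> \<open>On this neighbourhood of \<open>0\<close> all chart expressions for
      \<open>u\<close>, \<open>v\<close> and their quotient are valid.\<close>
    define S' where "S' = ({h \<in> S. u h \<in> U} \<inter> {h \<in> S. v h \<in> U}) \<inter> ({h \<in> S. inv (v h) \<in> U} \<inter> {h \<in> S. u h \<otimes> inv (v h) \<in> U})"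
    have "open S'"
      unfolding S'_def by (intro open_Int open_preimage_U continuous_map_mult continuous_map_inv cu cv S)
    have uv0: "u 0 = \<one>" "v 0 = \<one>"
      using carr[OF t] by (auto simp: u_def v_def)
    then have "0 \<in> S'"
      using S by (simp add: S'_def one_in_U)
    have u': "((\<lambda>h. \<phi> (u h)) has_derivative (\<lambda>h. h *\<^sub>R \<xi>)) (at 0)"
      and v': "((\<lambda>h. \<phi> (v h)) has_derivative (\<lambda>h. h *\<^sub>R \<xi>)) (at 0)"
      using y1(2)[OF t] y2(2)[OF t] by (simp_all add: has_left_log_derivative_def has_vector_derivative_def u_def v_def)
    obtain iv' where iv': "(iv has_derivative iv') (at e)"
      using iv_differentiable[OF e_in_iv_dom] differentiable_def by blast
    have "(iv has_derivative iv') (at (\<phi> (v 0)))"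
      using iv' uv0 by simp
    from mul_has_derivative[OF u' has_derivative_compose[OF v' this]]
    have w': "((\<lambda>h. mul (\<phi> (u h), iv (\<phi> (v h)))) has_derivative (\<lambda>h. 0)) (at 0)"
      using uv0 in_mul_dom(1)[OF e_in] dm_inverse[OF iv'] by (simp add: iv_e)
    have w0: "mul (\<phi> (u 0), iv (\<phi> (v 0))) = e"
      using uv0 by (simp add: iv_e mul_\<phi> one_in_U)
    \<comment> \<open>The outer factors are fixed in \<open>h\<close>, so \<open>?K\<close> only has
      to be differentiable at \<open>e\<close>.\<close>
    let ?K = "\<lambda>x. \<phi> (y1 t \<otimes> \<psi> x \<otimes> inv (y2 t))"
    obtain K' where "(?K has_derivative K') (at e)"
      using has_derivative_translation[OF U[OF t]] by blast
    then have K': "linear K'" "(?K has_derivative K') (at (mul (\<phi> (u 0), iv (\<phi> (v 0)))))"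
      unfolding w0 using has_derivative_linear by auto
    have "((\<lambda>h. ?K (mul (\<phi> (u h), iv (\<phi> (v h))))) has_derivative (\<lambda>h. 0)) (at 0)"
      using has_derivative_compose[OF w' K'(2)] K'(1) by (simp add: linear_0)
    then have "((\<lambda>h. \<phi> (?d (t + h))) has_derivative (\<lambda>h. 0)) (at 0)"
    proof (rule has_derivative_transform_within_open[OF _ \<open>open S'\<close> \<open>0 \<in> S'\<close>])
      fix h assume h: "h \<in> S'"
      then have h': "t + h \<in> I" by (simp add: S'_def S_def)
      have "\<psi> (mul (\<phi> (u h), iv (\<phi> (v h)))) = u h \<otimes> inv (v h)"
        using h by (simp add: S'_def iv_def mul_\<phi>)
      also have "\<dots> = inv (y1 t) \<otimes> y1 (t + h) \<otimes> inv (y2 (t + h)) \<otimes> y2 t"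
        using carr[OF t] carr[OF h'] by (simp add: u_def v_def inv_mult_group m_assoc)
      finally have "y1 t \<otimes> \<psi> (mul (\<phi> (u h), iv (\<phi> (v h)))) \<otimes> inv (y2 t) =
          (y1 t \<otimes> inv (y1 t)) \<otimes> (?d (t + h)) \<otimes> (y2 t \<otimes> inv (y2 t))"
        using carr[OF t] carr[OF h'] by (simp only: m_assoc inv_closed m_closed)
      then show "?K (mul (\<phi> (u h), iv (\<phi> (v h)))) = \<phi> (?d (t + h))"
        using carr[OF t] carr[OF h'] by simp
    qed
    \<comment> \<open>Writing \<open>0\<close> as \<open>t - t\<close> prepares the chain rule with
      the shift by \<open>- t\<close>, which moves the derivative from \<open>0\<close> to
      \<open>t\<close>.\<close>
    then have "((\<lambda>h. \<phi> (?d (t + h))) has_derivative (\<lambda>h. 0)) (at (t - t))" by simp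
    from has_derivative_compose[OF has_derivative_diff[OF has_derivative_ident has_derivative_const] this]
    show ?thesis by simp
  qed
  from has_derivative_zero_unique_connected[OF I this \<open>s \<in> I\<close> \<open>t \<in> I\<close>]
  show ?thesis
    by (rule inj_onD[OF inj_on_U _ U(3)[OF \<open>s \<in> I\<close>] U(3)[OF \<open>t \<in> I\<close>]])
qed

lemma continuous_map_pow:
  "continuous_map X T f \<Longrightarrow> continuous_map X T (\<lambda>x. f x [^] (n::nat))"
  by (induction n) (auto intro: continuous_map_mult simp: topspace_carrier)

subsection \<open>One-parameter subgroups\<close>

lemma homomorphism_zero:
  fixes c :: "real \<Rightarrow> 'g"
  assumes "\<And>t. c t \<in> carrier G" "\<And>s t. c (s + t) = c s \<otimes> c t"
  shows "c 0 = \<one>"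
  using assms(1)[of 0] assms(2)[of 0 0] by (metis add_0 l_cancel_one)

lemma homomorphism_pow:
  fixes c :: "real \<Rightarrow> 'g"
  assumes "\<And>t. c t \<in> carrier G" "\<And>s t. c (s + t) = c s \<otimes> c t"
  shows "c (real n * t) = c t [^] n"
proof (induction n)
  case 0
  then show ?case using homomorphism_zero[OF assms] by simp
next
  case (Suc n)
  have "c (real (Suc n) * t) = c (real n * t + t)"
    by (simp add: algebra_simps)
  with Suc assms(2) show ?case by simp
qed

text \<open>As \<open>inv (c t) \<otimes> c (t + h) = c h\<close>, the left logarithmic derivative
  at every \<open>t\<close> is the velocity at \<open>0\<close>.\<close>

lemma one_parameter_subgroupD:
  assumes "one_parameter_subgroup G T \<phi> \<xi> c"
  shows "continuous_map (top_of_set S) T c" "c t \<in> carrier G" "c (s + t) = c s \<otimes> c t"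
    "((\<lambda>t. \<phi> (c t)) has_vector_derivative \<xi>) (at 0)" "c 0 = \<one>"
    "has_left_log_derivative c \<xi> t"
proof -
  have c: "continuous_map euclideanreal T c" and hom: "\<And>s t. c (s + t) = c s \<otimes> c t"
    and "((\<lambda>t. \<phi> (c t)) has_vector_derivative \<xi>) (at 0)"
    using assms by (auto simp: one_parameter_subgroup_def)
  then show "continuous_map (top_of_set S) T c" "c (s + t) = c s \<otimes> c t"
    "((\<lambda>t. \<phi> (c t)) has_vector_derivative \<xi>) (at 0)"
    by (auto intro: continuous_map_from_subtopology)
  have carr: "c t \<in> carrier G" for t
    using continuous_map_carrier[of UNIV c t] c by simp
  then show "c t \<in> carrier G" "c 0 = \<one>"
    using homomorphism_zero hom by auto
  have "inv (c t) \<otimes> c (t + h) = c h" for h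
    using carr hom by (simp flip: m_assoc)
  then show "has_left_log_derivative c \<xi> t"
    using \<open>(_ has_vector_derivative \<xi>) (at 0)\<close> by (simp add: has_left_log_derivative_def)
qed

text \<open>Near \<open>0\<close> the quotient is constant, hence trivial; an arbitrary
  \<open>t\<close> is reached by raising the values at \<open>t / n\<close> to the power
  \<open>n\<close>.\<close>

lemma one_parameter_subgroup_unique:
  assumes c1: "one_parameter_subgroup G T \<phi> \<xi> c1" and c2: "one_parameter_subgroup G T \<phi> \<xi> c2"
  shows "c1 = c2"
proof
  fix t
  note c1D = one_parameter_subgroupD[OF c1] and c2D = one_parameter_subgroupD[OF c2]
  have "open ({t \<in> UNIV. c1 t \<in> U} \<inter> {t \<in> UNIV. inv (c2 t) \<in> U} \<inter> {t \<in> UNIV. c1 t \<otimes> inv (c2 t) \<in> U})"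
    by (intro open_Int open_preimage_U continuous_map_mult continuous_map_inv c1D c2D open_UNIV)
  moreover have "0 \<in> {t \<in> UNIV. c1 t \<in> U} \<inter> {t \<in> UNIV. inv (c2 t) \<in> U} \<inter> {t \<in> UNIV. c1 t \<otimes> inv (c2 t) \<in> U}"
    by (simp add: c1D(5) c2D(5) one_in_U)
  ultimately obtain \<delta> where \<delta>: "\<delta> > 0"
    "ball 0 \<delta> \<subseteq> {t \<in> UNIV. c1 t \<in> U} \<inter> {t \<in> UNIV. inv (c2 t) \<in> U} \<inter> {t \<in> UNIV. c1 t \<otimes> inv (c2 t) \<in> U}"
    by (rule openE)
  have in_U: "c1 t \<in> U" "inv (c2 t) \<in> U" "c1 t \<otimes> inv (c2 t) \<in> U" if "t \<in> ball 0 \<delta>" for t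
    using subsetD[OF \<delta>(2) that] by auto
  have eq: "c1 s = c2 s" if s: "s \<in> ball 0 \<delta>" for s
  proof -
    have "c1 s \<otimes> inv (c2 s) = c1 0 \<otimes> inv (c2 0)"
      by (rule quotient_constant[OF open_ball convex_connected[OF convex_ball] c1D(1,6) c2D(1,6) in_U s])
        (simp_all add: \<delta>(1))
    then have "c1 s \<otimes> inv (c2 s) \<otimes> c2 s = \<one> \<otimes> c2 s"
      by (simp add: c1D(5) c2D(5))
    then show ?thesis
      using c1D(2) c2D(2) by (simp add: m_assoc)
  qed
  obtain n where n: "\<bar>t\<bar> / \<delta> < real n"
    using reals_Archimedean2 by blast
  have "real n > 0"
    using n \<delta>(1) by (meson abs_ge_zero divide_nonneg_pos le_less_trans)
  then have "t / real n \<in> ball 0 \<delta>"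
    using n \<delta>(1) by (simp add: field_simps)
  from eq[OF this] have "c1 (t / real n) [^] n = c2 (t / real n) [^] n" by simp
  then show "c1 t = c2 t"
    using \<open>real n > 0\<close> homomorphism_pow[OF c1D(2,3), of n "t / real n"]
      homomorphism_pow[OF c2D(2,3), of n "t / real n"] by simp
qed

section \<open>Existence of one-parameter subgroups\<close>

lemma local_integral_curve:
  obtains \<delta> x where "\<delta> > 0" "x 0 = e"
    "\<And>t. t \<in> {-\<delta><..<\<delta>} \<Longrightarrow> x t \<in> iv_dom \<and> (x has_vector_derivative dm (x t, e) (0, \<xi>)) (at t)"
proof -
  obtain r where r: "r > 0" "cball e r \<subseteq> iv_dom"
    using open_iv_dom e_in_iv_dom open_contains_cball by metis
  let ?V = "\<lambda>x. dm (x, e) (0, \<xi>)"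
  let ?DV = "\<lambda>x h. frechet_derivative (\<lambda>p. dm p (0, \<xi>)) (at (x, e)) (h, 0)"
  have dom: "(x, e) \<in> mul_dom" if "x \<in> cball e r" for x
    using that r in_mul_dom(1) by (auto simp: iv_dom_def)
  have V': "(?V has_derivative ?DV x) (at x)" if "x \<in> cball e r" for x
  proof -
    have "((\<lambda>p. dm p (0, \<xi>)) has_derivative frechet_derivative (\<lambda>p. dm p (0, \<xi>)) (at (x, e))) (at (x, e))"
      using mul_C2(2)[OF dom[OF that]] frechet_derivative_works by blast
    from has_derivative_compose[OF has_derivative_Pair[OF has_derivative_ident has_derivative_const] this]
    show ?thesis by simp
  qed
  have cont_V': "continuous_on (cball e r) (\<lambda>x. ?DV x h)" for h
    by (rule continuous_on_compose2[OF mul_C2(3)]) (auto intro!: continuous_intros dom)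
  obtain L where L: "L-lipschitz_on (cball e r) ?V"
    using C1_lipschitz_on_compact_convex[OF compact_cball convex_cball V' cont_V'] by blast
  \<comment> \<open>Composition with the projection onto the ball extends the locally Lipschitz left
    invariant field to a globally Lipschitz one. For short times the solution stays in the ball,
    where \<open>P\<close> is the identity.\<close>
  define P where "P = closest_point (cball e r)"
  have P: "P x \<in> cball e r" for x
    using closest_point_in_set[of "cball e r" x] r by (auto simp: P_def)
  have "1-lipschitz_on UNIV P"
    using closest_point_lipschitz[of "cball e r"] r by (auto intro!: lipschitz_onI simp: P_def)
  from lipschitz_on_compose2[OF this lipschitz_on_subset[OF L]]
  have "(L * 1)-lipschitz_on UNIV (\<lambda>x. ?V (P x))"
    using P by (auto simp: image_subset_iff)
  then obtain \<delta> x where x: "\<delta> > 0" "x 0 = e"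
      "\<And>t. t \<in> {-\<delta><..<\<delta>} \<Longrightarrow> (x has_vector_derivative ?V (P (x t))) (at t)"
    using Picard_Lindeloef_global[of _ "\<lambda>x. ?V (P x)" e] by metis
  have "continuous (at 0) x"
    using x(3)[of 0] x(1) has_vector_derivative_continuous by auto
  then obtain d where d: "d > 0" "\<And>t. \<bar>t\<bar> < d \<Longrightarrow> dist (x t) e < r"
    using r(1) x(2) unfolding continuous_at_eps_delta by (metis dist_real_def diff_zero)
  show ?thesis
  proof
    show "min d \<delta> > 0" "x 0 = e" using d x by auto
    fix t assume t: "t \<in> {- min d \<delta><..<min d \<delta>}"
    then have "x t \<in> cball e r"
      using d(2)[of t] by (auto simp: dist_commute less_imp_le)
    moreover from this have "P (x t) = x t"
      by (simp add: P_def closest_point_self)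
    ultimately show "x t \<in> iv_dom \<and> (x has_vector_derivative ?V (x t)) (at t)"
      using r(2) x(3)[of t] t by auto
  qed
qed

text \<open>The velocity is the left invariant field at \<open>x t\<close>, and
  \<open>dm_iv_dm\<close> translates it back to \<open>\<xi>\<close>.\<close>

lemma integral_curve_has_left_log_derivative:
  assumes "(x has_vector_derivative dm (x t, e) (0, \<xi>)) (at t)" "x t \<in> iv_dom"
  shows "has_left_log_derivative (\<lambda>t. \<psi> (x t)) \<xi> t"
proof -
  have "(x has_derivative (\<lambda>h. h *\<^sub>R dm (x t, e) (0, \<xi>))) (at (t + 0))"
    using assms(1) by (simp add: has_vector_derivative_def)
  from has_derivative_compose[OF has_derivative_add[OF has_derivative_const has_derivative_ident] this]
  have "((\<lambda>h. x (t + h)) has_derivative (\<lambda>h. h *\<^sub>R dm (x t, e) (0, \<xi>))) (at 0)" by simp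
  from mul_has_derivative[OF has_derivative_const[of "iv (x t)"] this]
  have "((\<lambda>h. mul (iv (x t), x (t + h))) has_derivative
      (\<lambda>h. dm (iv (x t), x t) (0, h *\<^sub>R dm (x t, e) (0, \<xi>)))) (at 0)"
    using in_mul_dom(2)[OF assms(2)] by simp
  moreover have "dm (iv (x t), x t) (0, h *\<^sub>R v) = h *\<^sub>R dm (iv (x t), x t) (0, v)" for h v
    using linear_scale[OF linear_dm[OF in_mul_dom(2)[OF assms(2)]], of h "(0, v)"] by simp
  \<comment> \<open>This holds for every \<open>h\<close>, since \<open>mul\<close> is given by the
    same formula also outside \<open>mul_dom\<close>.\<close>
  moreover have "mul (iv (x t), x (t + h)) = \<phi> (inv (\<psi> (x t)) \<otimes> \<psi> (x (t + h)))" for h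
    using assms(2) by (simp add: mul_def iv_def iv_dom_def)
  ultimately show ?thesis
    by (simp add: has_left_log_derivative_def has_vector_derivative_def dm_iv_dm[OF assms(2)])
qed

text \<open>For fixed \<open>s\<close>, the curves \<open>c (s + t)\<close> and \<open>c t\<close>
  in \<open>t\<close> have the same left logarithmic derivative, so their quotient keeps its value
  \<open>c s\<close> at \<open>t = 0\<close>.\<close>

lemma local_one_parameter_subgroup:
  obtains \<delta> c where "\<delta> > 0" "continuous_map (top_of_set {-\<delta><..<\<delta>}) T c"
    "\<And>s t. \<lbrakk>s \<in> {-\<delta><..<\<delta>}; t \<in> {-\<delta><..<\<delta>}\<rbrakk> \<Longrightarrow> c (s + t) = c s \<otimes> c t"
    "((\<lambda>t. \<phi> (c t)) has_vector_derivative \<xi>) (at 0)"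
proof -
  obtain \<delta> x where x: "\<delta> > 0" "x 0 = e"
    and x': "\<And>t. t \<in> {-\<delta><..<\<delta>} \<Longrightarrow> x t \<in> iv_dom \<and> (x has_vector_derivative dm (x t, e) (0, \<xi>)) (at t)"
    using local_integral_curve by blast
  define c where "c = (\<lambda>t. \<psi> (x t))"
  let ?I = "{-\<delta><..<\<delta>}"
  have x_in: "x t \<in> \<phi> ` U" if "t \<in> ?I" for t
    using x'[OF that] by (simp add: iv_dom_def)
  have "continuous_on ?I x"
    using x' by (meson continuous_at_imp_continuous_on has_vector_derivative_continuous)
  then have c: "continuous_map (top_of_set ?I) T c"
    unfolding c_def by (rule continuous_map_reparam[OF continuous_map_\<psi>]) (use x_in in blast)
  have c_in: "c t \<in> U" "inv (c t) \<in> U" if "t \<in> ?I" for t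
    using x'[OF that] by (auto simp: c_def iv_dom_def)
  have c0: "c 0 = \<one>"
    by (simp add: c_def x one_in_U)
  have c_log: "has_left_log_derivative c \<xi> t" if "t \<in> ?I" for t
    unfolding c_def using x'[OF that] integral_curve_has_left_log_derivative by blast
  \<comment> \<open>Half the interval, so that sums of two parameters stay in
    \<open>?I\<close>.\<close>
  let ?J = "{-\<delta>/2<..<\<delta>/2}"
  have "open {p \<in> ?J \<times> ?J. c (fst p + snd p) \<otimes> inv (c (snd p)) \<in> U}"
    by (intro open_preimage_U continuous_map_mult continuous_map_inv continuous_map_reparam[OF c]
        continuous_intros open_Times) auto
  moreover have "(0, 0) \<in> {p \<in> ?J \<times> ?J. c (fst p + snd p) \<otimes> inv (c (snd p)) \<in> U}"
    using x(1) by (simp add: c0 one_in_U)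
  ultimately obtain A B where AB: "open A" "open B" "(0, 0) \<in> A \<times> B"
    "A \<times> B \<subseteq> {p \<in> ?J \<times> ?J. c (fst p + snd p) \<otimes> inv (c (snd p)) \<in> U}"
    by (rule open_prod_elim)
  then have "open (A \<inter> B)" "0 \<in> A \<inter> B" by auto
  then obtain d where d: "d > 0" "ball 0 d \<subseteq> A \<inter> B"
    by (rule openE)
  have dJ: "s + t \<in> ?I" "s \<in> ?I" "c (s + t) \<otimes> inv (c t) \<in> U" if "s \<in> ball 0 d" "t \<in> ball 0 d" for s t
  proof -
    have "(s, t) \<in> A \<times> B" using that d by auto
    with AB(4) show "s + t \<in> ?I" "s \<in> ?I" "c (s + t) \<otimes> inv (c t) \<in> U" by auto
  qed
  have "c (s + t) = c s \<otimes> c t" if s: "s \<in> ball 0 d" and t: "t \<in> ball 0 d" for s t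
  proof -
    have "c (s + t) \<otimes> inv (c t) = c (s + 0) \<otimes> inv (c 0)"
    proof (rule quotient_constant[where I = "ball 0 d" and \<xi> = \<xi> and ?y1.0 = "\<lambda>t. c (s + t)"])
      show "continuous_map (top_of_set (ball 0 d)) T (\<lambda>t. c (s + t))"
      proof (rule continuous_map_reparam[OF c])
        show "(+) s ` ball 0 d \<subseteq> ?I" using dJ(1)[OF s] by blast
      qed (intro continuous_intros)
      show "continuous_map (top_of_set (ball 0 d)) T c"
        by (rule continuous_map_from_subtopology_mono[OF c]) (use dJ(2) in blast)
      fix t :: real assume t: "t \<in> ball 0 d"
      show "has_left_log_derivative (\<lambda>t. c (s + t)) \<xi> t"
        using c_log[OF dJ(1)[OF s t]] by (simp add: has_left_log_derivative_def add.assoc)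
    qed (use d s t dJ c_log c_in in \<open>auto simp: convex_connected\<close>)
    also have "\<dots> = c s"
      using c_in(1)[OF dJ(2)[OF s s]] U_subset by (simp add: c0)
    finally have "c (s + t) \<otimes> inv (c t) \<otimes> c t = c s \<otimes> c t" by simp
    moreover have "c (s + t) \<in> carrier G" "c t \<in> carrier G"
      using c_in(1)[OF dJ(1)[OF s t]] c_in(1)[OF dJ(2)[OF t t]] U_subset by auto
    ultimately show ?thesis by (simp add: m_assoc)
  qed
  moreover have "((\<lambda>t. \<phi> (c t)) has_vector_derivative \<xi>) (at 0)"
  proof (rule has_vector_derivative_transform_within_open)
    show "(x has_vector_derivative \<xi>) (at 0)"
      using x'[of 0] x by (simp add: dm_left_unit)
    show "open ?I" "0 \<in> ?I" using x by auto
  qed (simp add: c_def x_in)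
  moreover have "continuous_map (top_of_set (ball 0 d)) T c"
    by (rule continuous_map_from_subtopology_mono[OF c]) (use dJ(2) in blast)
  moreover have "ball 0 d = {-d<..<d}"
    by (auto simp: ball_eq_greaterThanLessThan)
  ultimately show ?thesis
    using d(1) that[of d c] by simp
qed

text \<open>The value \<open>c (t / n) [^] n\<close> is the same for all large \<open>n\<close>, by
  passing to a common refinement. It is multiplicative because \<open>c (s / n)\<close> and
  \<open>c (t / n)\<close> commute.\<close>

lemma extend_local_homomorphism:
  assumes \<delta>: "\<delta> > 0" and cont: "continuous_map (top_of_set {-\<delta><..<\<delta>}) T c"
    and hom: "\<And>s t. \<lbrakk>s \<in> {-\<delta><..<\<delta>}; t \<in> {-\<delta><..<\<delta>}\<rbrakk> \<Longrightarrow> c (s + t) = c s \<otimes> c t"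
  obtains C where "continuous_map euclideanreal T C" "\<And>s t. C (s + t) = C s \<otimes> C t"
    "\<And>t. t \<in> {-\<delta><..<\<delta>} \<Longrightarrow> C t = c t"
proof -
  let ?I = "{-\<delta><..<\<delta>}"
  have carr: "c t \<in> carrier G" if "t \<in> ?I" for t
    using continuous_map_carrier[OF cont that] .
  have c0: "c 0 = \<one>"
    using hom[of 0 0] carr[of 0] \<delta> by (metis add_0 greaterThanLessThan_iff l_cancel_one neg_less_0_iff_less)
  have in_I: "t / real n \<in> ?I" if "\<bar>t\<bar> < real n * \<delta>" "n > 0" for t n
    using that by (simp add: field_simps abs_less_iff)
  have pow: "c (real k * t) = c t [^] k" if "\<bar>real k * t\<bar> < \<delta>" "\<bar>t\<bar> < \<delta>" for k t
    using that(1)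
  proof (induction k)
    case 0
    then show ?case by (simp add: c0)
  next
    case (Suc k)
    have "\<bar>real k * t\<bar> \<le> \<bar>real (Suc k) * t\<bar>"
      unfolding abs_mult by (intro mult_right_mono) auto
    with Suc.prems have k: "\<bar>real k * t\<bar> < \<delta>" by linarith
    have "c (real (Suc k) * t) = c (real k * t + t)"
      by (simp add: algebra_simps)
    also have "\<dots> = c (real k * t) \<otimes> c t"
      using k that(2) by (intro hom) (auto simp: abs_less_iff)
    finally show ?case
      using Suc.IH[OF k] by simp
  qed
  \<comment> \<open>The successor makes \<open>t / N t\<close> lie strictly inside the interval and
    keeps \<open>N t\<close> positive.\<close>
  define N where "N = (\<lambda>t. Suc (nat \<lceil>\<bar>t\<bar> / \<delta>\<rceil>))"
  have N: "\<bar>t\<bar> < real (N t) * \<delta>" "N t > 0" for t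
  proof -
    have "\<bar>t\<bar> / \<delta> < real (N t)"
      unfolding N_def by linarith
    then show "\<bar>t\<bar> < real (N t) * \<delta>"
      using \<delta> by (simp add: field_simps)
  qed (simp add: N_def)
  define C where "C = (\<lambda>t. c (t / real (N t)) [^] N t)"
  have C: "C t = c (t / real n) [^] n" if t: "\<bar>t\<bar> < real n * \<delta>" and n: "n > 0" for t n
  proof -
    \<comment> \<open>Used for \<open>n\<close> and for \<open>N t\<close>: both values equal the
      one with denominator \<open>n\<close> times \<open>N t\<close>.\<close>
    have refine: "c (t / real k) [^] k = c (t / (real k * real m)) [^] (k * m)"
      if k: "\<bar>t\<bar> < real k * \<delta>" "k > 0" and m: "m > 0" for k m
    proof -
      have tk: "t / real k \<in> ?I" using in_I[OF k] .
      have "\<bar>t / (real k * real m)\<bar> \<le> \<bar>t / real k\<bar>"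
        using k(2) m by (simp add: abs_divide frac_le mult_le_cancel_left1)
      then have tkm: "\<bar>t / (real k * real m)\<bar> < \<delta>"
        using tk by (auto simp: abs_less_iff)
      then have tkm': "t / (real k * real m) \<in> ?I"
        by (simp only: greaterThanLessThan_iff) linarith
      have eq: "real m * (t / (real k * real m)) = t / real k"
        using m by simp
      have "c (real m * (t / (real k * real m))) = c (t / (real k * real m)) [^] m"
        by (rule pow) (unfold eq, use tk tkm in \<open>auto simp: abs_less_iff\<close>)
      then show ?thesis
        using nat_pow_pow[OF carr[OF tkm']] by (simp only: eq mult.commute[of k])
    qed
    show ?thesis
      unfolding C_def using refine[OF N n] refine[OF t n N(2)[of t]] by (simp add: mult.commute)
  qed
  have "C (s + t) = C s \<otimes> C t" for s t
  proof -
    \<comment> \<open>One denominator that is large enough for \<open>s\<close>, \<open>t\<close>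
      and \<open>s + t\<close> at once.\<close>
    define n where "n = N (\<bar>s\<bar> + \<bar>t\<bar>)"
    have "\<bar>\<bar>s\<bar> + \<bar>t\<bar>\<bar> < real n * \<delta>" and n: "n > 0"
      using N[of "\<bar>s\<bar> + \<bar>t\<bar>"] by (simp_all add: n_def)
    then have le: "\<bar>s\<bar> < real n * \<delta>" "\<bar>t\<bar> < real n * \<delta>" "\<bar>s + t\<bar> < real n * \<delta>"
      by linarith+
    note s = in_I[OF le(1) n] and t = in_I[OF le(2) n]
    have comm: "c (s / real n) \<otimes> c (t / real n) = c (t / real n) \<otimes> c (s / real n)"
      using hom[OF s t] hom[OF t s] by (simp add: add.commute)
    show ?thesis
      by (simp only: C[OF le(1) n] C[OF le(2) n] C[OF le(3) n] add_divide_distrib hom[OF s t]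
          pow_mult_distrib[OF comm carr[OF s] carr[OF t]])
  qed
  moreover have "C t = c t" if "t \<in> ?I" for t
    using C[of t 1] that carr by (auto simp: abs_less_iff)
  moreover have "continuous_map euclideanreal T C"
    unfolding continuous_map_def
  proof (intro conjI allI impI)
    have "C t \<in> carrier G" for t
      unfolding C_def using carr[OF in_I[OF N]] by simp
    then show "C \<in> topspace euclideanreal \<rightarrow> topspace T"
      by (simp add: topspace_carrier)
    fix A assume A: "openin T A"
    have "open {t. C t \<in> A}"
    proof (subst open_subopen, intro ballI)
      fix t assume t: "t \<in> {t. C t \<in> A}"
      \<comment> \<open>\<open>N\<close> may jump, so its value at \<open>t\<close> is frozen; by
        \<open>C\<close> the formula with this exponent represents the extension on all of
        \<open>?J\<close>.\<close>
      let ?n = "N t"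
      let ?J = "{- (real ?n * \<delta>)<..<real ?n * \<delta>}"
      have "continuous_map (top_of_set ?J) T (\<lambda>s. c (s / real ?n) [^] ?n)"
      proof (intro continuous_map_pow continuous_map_reparam[OF cont])
        show "(\<lambda>s. s / real ?n) ` ?J \<subseteq> ?I"
          using in_I N(2) by (auto simp: abs_less_iff)
      qed (use N(2) in \<open>auto intro!: continuous_intros\<close>)
      then have "open {s \<in> ?J. c (s / real ?n) [^] ?n \<in> A}"
        by (rule open_preimage) (use A in auto)
      moreover have "t \<in> {s \<in> ?J. c (s / real ?n) [^] ?n \<in> A}"
        using t N(1)[of t] by (auto simp: C_def abs_less_iff)
      moreover have "{s \<in> ?J. c (s / real ?n) [^] ?n \<in> A} \<subseteq> {t. C t \<in> A}"
      proof
        fix s assume s: "s \<in> {s \<in> ?J. c (s / real ?n) [^] ?n \<in> A}"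
        then have "\<bar>s\<bar> < real ?n * \<delta>" by (auto simp: abs_less_iff)
        from C[OF this N(2)] s show "s \<in> {t. C t \<in> A}" by simp
      qed
      ultimately show "\<exists>S. open S \<and> t \<in> S \<and> S \<subseteq> {t. C t \<in> A}" by blast
    qed
    then show "openin euclideanreal {t \<in> topspace euclideanreal. C t \<in> A}" by simp
  qed
  ultimately show ?thesis using that by blast
qed

lemma one_parameter_subgroup_exists:
  obtains C where "one_parameter_subgroup G T \<phi> \<xi> C"
proof -
  obtain \<delta> c where c: "\<delta> > 0" "continuous_map (top_of_set {-\<delta><..<\<delta>}) T c"
    "\<And>s t. \<lbrakk>s \<in> {-\<delta><..<\<delta>}; t \<in> {-\<delta><..<\<delta>}\<rbrakk> \<Longrightarrow> c (s + t) = c s \<otimes> c t"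
    "((\<lambda>t. \<phi> (c t)) has_vector_derivative \<xi>) (at 0)"
    using local_one_parameter_subgroup[of \<xi>] by blast
  from extend_local_homomorphism[OF c(1-3)] obtain C where
    C: "continuous_map euclideanreal T C" "\<And>s t. C (s + t) = C s \<otimes> C t"
    "\<And>t. t \<in> {-\<delta><..<\<delta>} \<Longrightarrow> C t = c t" by blast
  have "((\<lambda>t. \<phi> (C t)) has_vector_derivative \<xi>) (at 0)"
    by (rule has_vector_derivative_transform_within_open[OF c(4), of "{-\<delta><..<\<delta>}"]) (use c(1) C(3) in auto)
  with C(1,2) have "one_parameter_subgroup G T \<phi> \<xi> C"
    unfolding one_parameter_subgroup_def by blast
  then show ?thesis by (rule that)
qed

lemma one_parameter_subgroup_rescale:
  assumes "one_parameter_subgroup G T \<phi> \<xi> C"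
  shows "one_parameter_subgroup G T \<phi> (r *\<^sub>R \<xi>) (\<lambda>s. C (r * s))"
proof -
  note D = one_parameter_subgroupD[OF assms]
  have "continuous_map (top_of_set UNIV) T (\<lambda>s. C (r * s))"
    by (rule continuous_map_reparam[OF D(1)[of UNIV]]) (auto intro!: continuous_intros)
  moreover have "((\<lambda>s. \<phi> (C s)) has_derivative (\<lambda>h. h *\<^sub>R \<xi>)) (at (r * 0))"
    using D(4) by (simp add: has_vector_derivative_def)
  from has_derivative_compose[OF has_derivative_mult_right[OF has_derivative_ident] this]
  have "((\<lambda>s. \<phi> (C (r * s))) has_vector_derivative r *\<^sub>R \<xi>) (at 0)"
    by (simp add: has_vector_derivative_def mult.commute)
  ultimately show ?thesis
    by (simp add: one_parameter_subgroup_def D(3) distrib_left)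
qed

text \<open>Uniqueness identifies the \<open>THE\<close> in \<open>lie_exp\<close> with the rescaled
  subgroup, evaluated at \<open>1\<close>.\<close>

lemma lie_exp_scaleR:
  assumes "one_parameter_subgroup G T \<phi> \<xi> C"
  shows "lie_exp G T \<phi> (t *\<^sub>R \<xi>) = C t"
proof -
  note C = one_parameter_subgroup_rescale[OF assms, of t]
  have "(THE c. one_parameter_subgroup G T \<phi> (t *\<^sub>R \<xi>) c) = (\<lambda>s. C (t * s))"
    using C one_parameter_subgroup_unique by blast
  then show ?thesis by (simp add: lie_exp_def)
qed

subsection \<open>The Lie bracket is bilinear and alternating\<close>

text \<open>The derivative of conjugation as an explicit expression in \<open>dm\<close> and
  \<open>iv\<close>, so that its dependence on the group element can be differentiated.\<close>

definition Ad_chart :: "'a \<Rightarrow> 'a \<Rightarrow> 'a" where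
  "Ad_chart x \<eta> = dm (iv x, x) (dm (iv x, e) (0, \<eta>), 0)"

lemma Ad_has_derivative:
  assumes "g \<in> U" "inv g \<in> U"
  shows "((\<lambda>x. \<phi> (inv g \<otimes> \<psi> x \<otimes> g)) has_derivative Ad_chart (\<phi> g)) (at e)"
  using has_derivative_translation[OF assms(2,1)] assms U_subset
  by (simp add: Ad_chart_def[abs_def] iv_def one_in_U)

lemma Ad_eq_Ad_chart: "g \<in> U \<Longrightarrow> inv g \<in> U \<Longrightarrow> Ad G U \<phi> g = Ad_chart (\<phi> g)"
  unfolding Ad_def using frechet_derivative_at[OF Ad_has_derivative] by simp

lemma linear_Ad_chart:
  assumes "x \<in> iv_dom"
  shows "linear (Ad_chart x)"
proof -
  have "linear (dm (iv x, x))" "linear (dm (iv x, e))"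
    by (rule linear_dm[OF in_mul_dom(2)[OF assms]], rule linear_dm[OF in_mul_dom(1)[OF iv_in[OF assms]]])
  moreover have "linear (\<lambda>v::'a. (v, 0::'a))" "linear (\<lambda>v::'a. (0::'a, v))"
    by (auto intro!: linearI)
  ultimately have "linear (dm (iv x, x) \<circ> (\<lambda>v. (v, 0)) \<circ> (dm (iv x, e) \<circ> (\<lambda>v. (0, v))))"
    by (intro linear_compose)
  then show ?thesis by (simp add: o_def Ad_chart_def[abs_def])
qed

text \<open>\<open>mul_C2\<close> differentiates \<open>dm p v\<close> in \<open>p\<close> for fixed
  \<open>v\<close>, whereas the direction in \<open>Ad_chart\<close> varies with \<open>x\<close>.
  Expanding it in the basis leaves fixed directions with differentiable coefficients.\<close>

lemma Ad_chart_differentiable: "(\<lambda>x. Ad_chart x \<eta>) differentiable (at e)"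
proof -
  let ?\<alpha> = "\<lambda>x. dm (iv x, e) (0, \<eta>)"
  have iv: "iv differentiable (at e)"
    using iv_differentiable[OF e_in_iv_dom] .
  have ee: "(iv e, e) \<in> mul_dom"
    using in_mul_dom(2)[OF e_in_iv_dom] .
  \<comment> \<open>\<open>f\<close> will be the constant \<open>e\<close> or the identity.\<close>
  have diff: "(\<lambda>x. dm (iv x, f x) v) differentiable (at e)"
    if f: "f differentiable (at e)" "f e = e" for f v
  proof -
    obtain iv' where iv': "(iv has_derivative iv') (at e)"
      using iv differentiable_def by blast
    obtain f' where f': "(f has_derivative f') (at e)"
      using f(1)[unfolded differentiable_def] by blast
    obtain D where "((\<lambda>p. dm p v) has_derivative D) (at (iv e, e))"
      using mul_C2(2)[OF ee] differentiable_def by blast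
    then have "((\<lambda>p. dm p v) has_derivative D) (at (iv e, f e))"
      using f(2) by simp
    from has_derivative_compose[OF has_derivative_Pair[OF iv' f'] this]
    show ?thesis by (rule differentiableI)
  qed
  have "(\<lambda>x. \<Sum>b\<in>Basis. (?\<alpha> x \<bullet> b) *\<^sub>R dm (iv x, x) (b, 0)) differentiable (at e)"
    using diff[of "\<lambda>_. e"] diff[of "\<lambda>x. x"] by (intro differentiable_sum differentiable_scaleR
        finite_Basis ballI differentiable_inner differentiable_const) simp_all
  then obtain D where D: "((\<lambda>x. \<Sum>b\<in>Basis. (?\<alpha> x \<bullet> b) *\<^sub>R dm (iv x, x) (b, 0)) has_derivative D) (at e)"
    using differentiable_def by blast
  have "((\<lambda>x. Ad_chart x \<eta>) has_derivative D) (at e)"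
  proof (rule has_derivative_transform_within_open[OF D open_iv_dom e_in_iv_dom])
    fix x assume x: "x \<in> iv_dom"
    have lin: "linear (dm (iv x, x))"
      using linear_dm in_mul_dom(2)[OF x] .
    have "(?\<alpha> x, 0) = (\<Sum>b\<in>Basis. (?\<alpha> x \<bullet> b) *\<^sub>R (b, 0::'a))"
      by (rule prod_eqI) (simp_all add: fst_sum snd_sum euclidean_representation)
    then have "Ad_chart x \<eta> = dm (iv x, x) (\<Sum>b\<in>Basis. (?\<alpha> x \<bullet> b) *\<^sub>R (b, 0))"
      by (simp only: Ad_chart_def)
    also have "\<dots> = (\<Sum>b\<in>Basis. (?\<alpha> x \<bullet> b) *\<^sub>R dm (iv x, x) (b, 0))"
      by (simp only: linear_sum[OF lin] linear_scale[OF lin])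
    finally show "(\<Sum>b\<in>Basis. (?\<alpha> x \<bullet> b) *\<^sub>R dm (iv x, x) (b, 0)) = Ad_chart x \<eta>" ..
  qed
  then show ?thesis by (rule differentiableI)
qed

lemma eventually_Ad_exp:
  assumes "one_parameter_subgroup G T \<phi> \<xi> C"
  shows "\<exists>S. open S \<and> 0 \<in> S \<and> (\<forall>t\<in>S. C t \<in> U \<and> \<phi> (C t) \<in> iv_dom \<and>
    Ad_chart (\<phi> (C t)) = Ad G U \<phi> (lie_exp G T \<phi> (t *\<^sub>R \<xi>)))"
proof -
  note D = one_parameter_subgroupD[OF assms]
  let ?S = "{t \<in> UNIV. C t \<in> U} \<inter> {t \<in> UNIV. inv (C t) \<in> U}"
  have "open ?S"
    by (intro open_Int open_preimage_U continuous_map_inv D(1) open_UNIV)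
  moreover have "0 \<in> ?S" by (simp add: D(5) one_in_U)
  ultimately show ?thesis
    by (intro exI[of _ ?S]) (auto simp: lie_exp_scaleR[OF assms] Ad_eq_Ad_chart \<phi>_in_iv_dom)
qed

text \<open>The chain rule along the one-parameter subgroup of \<open>\<xi>\<close> replaces the
  exponential map by a Frechet derivative, whose linearity in \<open>\<xi>\<close> is
  automatic.\<close>

lemma lie_bracket_eq: "lie_bracket G T U \<phi> \<xi> \<eta> = frechet_derivative (\<lambda>x. Ad_chart x \<eta>) (at e) \<xi>"
proof -
  obtain C where C: "one_parameter_subgroup G T \<phi> \<xi> C"
    using one_parameter_subgroup_exists .
  note D = one_parameter_subgroupD[OF C]
  obtain S where S: "open S" "0 \<in> S"
    "\<And>t. t \<in> S \<Longrightarrow> C t \<in> U \<and> \<phi> (C t) \<in> iv_dom \<and> Ad_chart (\<phi> (C t)) = Ad G U \<phi> (lie_exp G T \<phi> (t *\<^sub>R \<xi>))"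
    using eventually_Ad_exp[OF C] by blast
  let ?D = "frechet_derivative (\<lambda>x. Ad_chart x \<eta>) (at e)"
  have A: "((\<lambda>x. Ad_chart x \<eta>) has_derivative ?D) (at (\<phi> (C 0)))"
    by (simp add: D(5) Ad_chart_differentiable flip: frechet_derivative_works)
  have "((\<lambda>t. \<phi> (C t)) has_derivative (\<lambda>h. h *\<^sub>R \<xi>)) (at 0)"
    using D(4) by (simp add: has_vector_derivative_def)
  from has_derivative_compose[OF this A]
  have "((\<lambda>t. Ad_chart (\<phi> (C t)) \<eta>) has_vector_derivative ?D \<xi>) (at 0)"
    using linear_scale[OF has_derivative_linear[OF A]] by (simp add: has_vector_derivative_def)
  then have "((\<lambda>t. Ad G U \<phi> (lie_exp G T \<phi> (t *\<^sub>R \<xi>)) \<eta>) has_vector_derivative ?D \<xi>) (at 0)"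
    by (rule has_vector_derivative_transform_within_open[OF _ S(1,2)]) (simp add: S(3))
  then show ?thesis
    unfolding lie_bracket_def by (rule vector_derivative_at)
qed

text \<open>The one-parameter subgroup of \<open>\<xi>\<close> is commutative, so that \<open>Ad (exp (t \<xi>))\<close> fixes \<open>\<xi>\<close>.\<close>

lemma lie_bracket_self: "lie_bracket G T U \<phi> \<xi> \<xi> = 0"
proof -
  obtain C where C: "one_parameter_subgroup G T \<phi> \<xi> C"
    using one_parameter_subgroup_exists .
  note D = one_parameter_subgroupD[OF C]
  obtain S where S: "open S" "0 \<in> S"
    "\<And>t. t \<in> S \<Longrightarrow> C t \<in> U \<and> \<phi> (C t) \<in> iv_dom \<and> Ad_chart (\<phi> (C t)) = Ad G U \<phi> (lie_exp G T \<phi> (t *\<^sub>R \<xi>))"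
    using eventually_Ad_exp[OF C] by blast
  have fixed: "Ad G U \<phi> (lie_exp G T \<phi> (t *\<^sub>R \<xi>)) \<xi> = \<xi>" if t: "t \<in> S" for t
  proof -
    have g: "C t \<in> U" and "\<phi> (C t) \<in> iv_dom"
      using S(3)[OF t] by blast+
    then have "inv (C t) \<in> U"
      unfolding iv_dom_def by simp
    note g = g this
    have A: "((\<lambda>x. \<phi> (inv (C t) \<otimes> \<psi> x \<otimes> C t)) has_derivative Ad_chart (\<phi> (C t))) (at (\<phi> (C 0)))"
      using Ad_has_derivative[OF g] by (simp add: D(5))
    have "((\<lambda>s. \<phi> (C s)) has_derivative (\<lambda>h. h *\<^sub>R \<xi>)) (at 0)"
      using D(4) by (simp add: has_vector_derivative_def)
    from has_derivative_compose[OF this A]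
    have "((\<lambda>s. \<phi> (inv (C t) \<otimes> \<psi> (\<phi> (C s)) \<otimes> C t)) has_vector_derivative Ad_chart (\<phi> (C t)) \<xi>) (at 0)"
      using linear_scale[OF has_derivative_linear[OF A]] by (simp add: has_vector_derivative_def)
    moreover have "((\<lambda>s. \<phi> (inv (C t) \<otimes> \<psi> (\<phi> (C s)) \<otimes> C t)) has_vector_derivative \<xi>) (at 0)"
    proof (rule has_vector_derivative_transform_within_open[OF D(4) S(1,2)])
      fix s assume s: "s \<in> S"
      have "C s \<otimes> C t = C t \<otimes> C s"
        using D(3)[of s t] D(3)[of t s] by (simp add: add.commute)
      then have "inv (C t) \<otimes> C s \<otimes> C t = C s"
        using D(2) by (simp add: m_assoc) (simp flip: m_assoc)
      then show "\<phi> (C s) = \<phi> (inv (C t) \<otimes> \<psi> (\<phi> (C s)) \<otimes> C t)"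
        using S(3)[OF s] by simp
    qed
    ultimately have "Ad_chart (\<phi> (C t)) \<xi> = \<xi>"
      by (rule vector_derivative_unique_at)
    with S(3)[OF t] show ?thesis by simp
  qed
  have "((\<lambda>t. Ad G U \<phi> (lie_exp G T \<phi> (t *\<^sub>R \<xi>)) \<xi>) has_vector_derivative 0) (at 0)"
    by (rule has_vector_derivative_transform_within_open[OF has_vector_derivative_const S(1,2)])
      (simp add: fixed)
  then show ?thesis
    unfolding lie_bracket_def by (rule vector_derivative_at)
qed

text \<open>Linearity in the second argument is that of \<open>Ad_chart x\<close> for
  \<open>x\<close> near \<open>e\<close>, differentiated; in the first it is that of a derivative.
  Boundedness is automatic in finite dimension.\<close>

lemma alternating_bracket_lie_bracket: "alternating_bracket (lie_bracket G T U \<phi>)"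
proof -
  let ?D = "\<lambda>\<eta>. frechet_derivative (\<lambda>x. Ad_chart x \<eta>) (at e)"
  have D: "((\<lambda>x. Ad_chart x \<eta>) has_derivative ?D \<eta>) (at e)" for \<eta>
    using Ad_chart_differentiable frechet_derivative_works by blast
  have eq: "?D \<eta> = D'" if "((\<lambda>x. f x) has_derivative D') (at e)" "\<And>x. x \<in> iv_dom \<Longrightarrow> f x = Ad_chart x \<eta>" for \<eta> f D'
    using frechet_derivative_at[OF has_derivative_transform_within_open[OF that(1) open_iv_dom e_in_iv_dom that(2)]]
    by simp
  have "?D (\<eta> + \<eta>') = (\<lambda>h. ?D \<eta> h + ?D \<eta>' h)" for \<eta> \<eta>'
    by (rule eq[OF has_derivative_add[OF D D]]) (simp add: linear_add[OF linear_Ad_chart])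
  moreover have "?D (r *\<^sub>R \<eta>) = (\<lambda>h. r *\<^sub>R ?D \<eta> h)" for r \<eta>
    by (rule eq[OF has_derivative_scaleR_right[OF D]]) (simp add: linear_scale[OF linear_Ad_chart])
  ultimately have "linear (\<lambda>\<eta>. lie_bracket G T U \<phi> \<xi> \<eta>)" for \<xi>
    by (intro linearI) (simp_all add: lie_bracket_eq)
  moreover have "linear (\<lambda>\<xi>. lie_bracket G T U \<phi> \<xi> \<eta>)" for \<eta>
    using has_derivative_linear[OF D[of \<eta>]] by (simp add: lie_bracket_eq)
  ultimately have "bounded_bilinear (lie_bracket G T U \<phi>)"
    by (simp add: bilinear_def flip: bilinear_conv_bounded_bilinear)
  then show ?thesis
    by (intro alternating_bracket.intro alternating_bracket_axioms.intro lie_bracket_self)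
qed

end

theorem mainTheorem20:
  fixes G :: "('g, 'm) monoid_scheme"
    and T :: "'g topology"
    and atlas :: "('g set \<times> ('g \<Rightarrow> 'a::euclidean_space)) set"
    and U :: "'g set" and \<phi> :: "'g \<Rightarrow> 'a"
    and E :: "'a \<times> ('a \<Rightarrow>\<^sub>L real) \<Rightarrow> real"
    and a b :: real
    and \<xi> :: "real \<Rightarrow> 'a" and \<nu> :: "real \<Rightarrow> 'a \<Rightarrow>\<^sub>L real"
  assumes "lie_group G T atlas"
    and "(U, \<phi>) \<in> atlas" and "\<one>\<^bsub>G\<^esub> \<in> U"
    and "smooth_on UNIV E"
    and "a < b"
    and "smooth_on {a..b} \<xi>" and "smooth_on {a..b} \<nu>"
  shows "let br = lie_bracket G T U \<phi> in
    extremal br E a b (\<lambda>t. (\<xi> t, \<nu> t)) \<longleftrightarrow>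
      (\<forall>t\<in>{a..b}.
        ((\<lambda>s. partial_fst E (\<xi> s) (\<nu> s)) has_vector_derivative
           (ad_star br (\<xi> t) (partial_fst E (\<xi> t) (\<nu> t))
             - ad_star br (partial_snd E (\<xi> t) (\<nu> t)) (\<nu> t))) (at t within {a..b}) \<and>
        ((\<lambda>s. partial_snd E (\<xi> s) (\<nu> s)) has_vector_derivative
           (- br (\<xi> t) (partial_snd E (\<xi> t) (\<nu> t)))) (at t within {a..b}))"
proof -
  interpret lie_group_chart G T atlas U \<phi>
    using assms(1-3) by (intro lie_group_chart.intro lie_group_chart_axioms.intro)
  \<comment> \<open>Here the Lie group meets the variational argument, which is stated for an
    abstract bracket.\<close>
  interpret alternating_bracket "lie_bracket G T U \<phi>"
    by (rule alternating_bracket_lie_bracket)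
  note curve = smooth_on_UNIV_C1_function[OF assms(4)] assms(5)
    smooth_on_curve_C1(3)[OF assms(5,6)] smooth_on_curve_C1(3)[OF assms(5,7)]
  show ?thesis
    unfolding Let_def
    using Euler_Poincare_if_extremal[OF curve] extremal_if_Euler_Poincare[OF curve] by blast
qed

end
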